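(* Let $k\ge1$, let $V_k(1)=\mathbb Q[h_1,\dots,h_k]$, and let $\mathcal I_k$ be the ideal of $V_k(1)$ generated by the Schur functions $S_{(\ell^{k+1-\ell})}$, $\ell=1,\dots,k$. Then (the images of) the homogeneous functions $h_\lambda$ indexed by $k$-irreducible partitions $\lambda$ form a basis of the quotient ring $V_k(1)/\mathcal I_k$.
   Context: $h_i$ is the complete homogeneous symmetric function of degree $i$, $h_\lambda=h_{\lambda_1}h_{\lambda_2}\cdots$ (with $h_0=1$), and $(\ell^{k+1-\ell})$ is the rectangular partition with $k+1-\ell$ parts equal to $\ell$ (a "$k$-rectangle"). The corresponding Schur function lies in $\mathbb Q[h_1,\dots,h_k]$. A partition (with all parts at most $k$) is called $k$-irreducible if, for each $i=0,1,\dots,k-1$, it has no more than $i$ parts equal to $k-i$; the empty partition is $k$-irreducible. *)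

theory Defs
  imports
    Complex_Main
    "HOL-Library.Multiset"
    "HOL-Algebra.Generated_Rings"
    "HOL-Algebra.Embedded_Algebras"
    "HOL-Algebra.QuotRing"
begin

text \<open>
  Formal power series with rational coefficients in countably many commuting variables
  \<open>x\<^sub>0, x\<^sub>1, \<dots>\<close>. The monomial \<open>x\<^bsub>i\<^esub> x\<^bsub>j\<^esub> \<cdots>\<close> is encoded by the multiset \<open>{#i, j, \<dots>#}\<close>, and a
  power series by its function of coefficients. Symmetric functions are particular elements of
  this ring.
\<close>

type_synonym mfps = "nat multiset \<Rightarrow> rat"

definition mfps_ring :: "mfps ring" where
  "mfps_ring =
     \<lparr>carrier = UNIV,
      monoid.mult = (\<lambda>f g M. \<Sum>(A, B) | A + B = M. f A * g B),
      one = (\<lambda>M. if M = {#} then 1 else 0),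
      zero = (\<lambda>M. 0),
      add = (\<lambda>f g M. f M + g M)\<rparr>"

definition mfps_const :: "rat \<Rightarrow> mfps" where
  "mfps_const c = (\<lambda>M. if M = {#} then c else 0)"

definition complete_hom :: "nat \<Rightarrow> mfps" where
  "complete_hom n = (\<lambda>M. if size M = n then 1 else 0)"

definition complete_homs :: "nat list \<Rightarrow> mfps" where
  "complete_homs la = foldr (\<lambda>p f. complete_hom p \<otimes>\<^bsub>mfps_ring\<^esub> f) la \<one>\<^bsub>mfps_ring\<^esub>"

definition is_partition :: "nat list \<Rightarrow> bool" where
  "is_partition la \<longleftrightarrow> sorted_wrt (\<ge>) la \<and> 0 \<notin> set la"

text \<open>Semistandard Young tableaux of shape \<open>la\<close> (given as the list of rows).\<close>

definition ssyt :: "nat list \<Rightarrow> nat list list \<Rightarrow> bool" where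
  "ssyt la T \<longleftrightarrow>
     map length T = la \<and>
     (\<forall>r\<in>set T. sorted r) \<and>
     (\<forall>i j. Suc i < length T \<and> j < length (T ! Suc i) \<longrightarrow> T ! i ! j < T ! Suc i ! j)"

text \<open>
  The Schur function is the sum over all semistandard tableaux \<open>T\<close> of shape \<open>la\<close> of the
  monomials given by the contents of \<open>T\<close>.
\<close>

definition schur :: "nat list \<Rightarrow> mfps" where
  "schur la = (\<lambda>M. of_nat (card {T. ssyt la T \<and> mset (concat T) = M}))"

text \<open>The ring \<open>V\<^sub>k(1) = \<rat>[h\<^sub>1, \<dots>, h\<^sub>k]\<close>, as a subring of the ring of power series.\<close>

definition V_ring :: "nat \<Rightarrow> mfps ring" where
  "V_ring k = mfps_ring
     \<lparr>carrier := generate_ring mfps_ring (range mfps_const \<union> complete_hom ` {1..k})\<rparr>"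

definition k_rectangle :: "nat \<Rightarrow> nat \<Rightarrow> nat list" where
  "k_rectangle k l = replicate (k + 1 - l) l"

definition rect_ideal :: "nat \<Rightarrow> mfps set" where
  "rect_ideal k = Idl\<^bsub>V_ring k\<^esub> ((\<lambda>l. schur (k_rectangle k l)) ` {1..k})"

definition V_quot :: "nat \<Rightarrow> mfps set ring" where
  "V_quot k = V_ring k Quot rect_ideal k"

definition quot_map :: "nat \<Rightarrow> mfps \<Rightarrow> mfps set" where
  "quot_map k f = rect_ideal k +>\<^bsub>V_ring k\<^esub> f"

text \<open>The scalars \<open>\<rat>\<close>, embedded into the quotient ring.\<close>

definition quot_scalars :: "nat \<Rightarrow> mfps set set" where
  "quot_scalars k = quot_map k ` range mfps_const"

definition k_irreducible :: "nat \<Rightarrow> nat list \<Rightarrow> bool" where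
  "k_irreducible k la \<longleftrightarrow>
     is_partition la \<and> (\<forall>p\<in>set la. p \<le> k) \<and> (\<forall>i<k. count_list la (k - i) \<le> i)"

text \<open>
  A finite family \<open>(v\<^bsub>a\<^esub>)\<close>, \<open>a \<in> A\<close>, is a basis of the \<open>K\<close>-algebra \<open>R\<close> if, listed in any order
  without repetition of indices, it is linearly independent and spans. As \<open>ring.independent\<close>
  refers to lists, this includes that the \<open>v\<^bsub>a\<^esub>\<close> are pairwise distinct.
\<close>

definition is_basis_family :: "('b, 'c) ring_scheme \<Rightarrow> 'b set \<Rightarrow> ('a \<Rightarrow> 'b) \<Rightarrow> 'a set \<Rightarrow> bool" where
  "is_basis_family R K v A \<longleftrightarrow>
     finite A \<and>
     (\<forall>as. distinct as \<and> set as = A \<longrightarrow>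
        ring.independent R K (map v as) \<and> ring.Span R K (map v as) = carrier R)"

end

theory Submission
  imports Defs "Jordan_Normal_Form.Determinant"
begin

text \<open>
The idea is to compare two families of elements of \<open>\<rat>[h\<^sub>1, \<dots>, h\<^sub>k]\<close> that are both indexed by the
multisets \<open>\<gamma>\<close> over \<open>{1..k}\<close>: the monomials \<open>h\<^sub>\<gamma>\<close>, and products of rectangular Schur functions and of
the \<open>h\<^sub>i\<close> which are adapted to the ideal.

Let \<open>m = k + 1 - l\<close>. By the Jacobi-Trudi identity (\<open>jacobi_trudi\<close>), the Schur function of \<open>(l\<^sup>m)\<close> is
the determinant of the \<open>m \<times> m\<close> matrix with entries \<open>h\<close> of index \<open>l - i + j\<close>. Every term of its
expansion is a product of \<open>m\<close> functions \<open>h\<close> whose indices add up to \<open>m l\<close> and are at most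
\<open>l + m - 1 = k\<close>. Give \<open>h\<^sub>i\<close> the weight \<open>i (2 k - i)\<close>. This is a strictly concave function of \<open>i\<close>, so
the diagonal term, the \<open>m\<close>-th power of \<open>h\<^sub>l\<close>, has strictly larger weight than all other terms
(\<open>has_lead_schur_rectangle\<close>).

Now divide each multiplicity \<open>\<gamma>\<^sub>l\<close> by \<open>k + 1 - l\<close> with remainder. The product of the rectangular
Schur functions, raised to the quotients, with the \<open>h\<^sub>l\<close>, raised to the remainders, has leading term
\<open>h\<^sub>\<gamma>\<close>. These products therefore arise from the monomials by a triangular change of family, and form
a basis of \<open>\<rat>[h\<^sub>1, \<dots>, h\<^sub>k]\<close> as the monomials do (\<open>indep_family_adapted\<close>, \<open>V_span_eq\<close>). Multiplying
one of them by a rectangular Schur function gives another one; so the ideal is spanned by those in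
which some quotient is positive (\<open>rect_ideal_eq\<close>), and the others are a basis of a complement.
But the quotients all vanish precisely when \<open>\<gamma>\<close> is irreducible, and then the product is \<open>h\<^sub>\<gamma>\<close> itself.

The argument needs the algebraic independence of the \<open>h\<^sub>i\<close> (\<open>indep_family_hsym\<close>). It follows by the
same triangularity principle: Newton's identity gives \<open>h\<^sub>n\<close> the leading term \<open>p\<^sub>n / n\<close>, where \<open>p\<^sub>n\<close> is
the power sum, and the independence of the products of power sums can be read off from
coefficients. The Jacobi-Trudi identity is proved by induction on the number of variables: for the
determinant the new variable is split off by row operations (\<open>jt_det_Suc\<close>), for the tableaux by
removing their largest entry (\<open>trunc_schur_Suc\<close>), and both lead to the same sum over interlacing
partitions.
\<close>

section \<open>The ring of power series as a type\<close>

text \<open>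
A copy of the power series that is a type with ring operations, so that the reasoning up to the
quotient ring can use the type classes of rings, finite sums and determinants.
\<close>

typedef mseries = "UNIV :: mfps set"
  morphisms coeff Mseries ..

lemma coeff_Mseries [simp]: "coeff (Mseries f) = f"
  by (simp add: Mseries_inverse)

lemma mseries_eqI: "(\<And>M. coeff f M = coeff g M) \<Longrightarrow> f = g"
  by (simp add: coeff_inject [symmetric] fun_eq_iff)

lemma finite_submultisets: "finite {A. A \<subseteq># M}"
proof (induction M)
  case (add x M)
  have "{A. A \<subseteq># add_mset x M} \<subseteq> {A. A \<subseteq># M} \<union> add_mset x ` {A. A \<subseteq># M}"
  proof
    fix A assume "A \<in> {A. A \<subseteq># add_mset x M}"
    then have A: "A \<subseteq># add_mset x M" by simp
    show "A \<in> {A. A \<subseteq># M} \<union> add_mset x ` {A. A \<subseteq># M}"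
    proof (cases "x \<in># A")
      case True
      then obtain B where "A = add_mset x B" by (metis multi_member_split)
      then show ?thesis using A by auto
    next
      case False
      then have "A \<subseteq># M" using A
        by (metis add_mset_remove_trivial diff_single_trivial subset_eq_diff_conv
          union_mset_add_mset_right add.right_neutral)
      then show ?thesis by simp
    qed
  qed
  then show ?case using add.IH by (meson finite_UnI finite_imageI finite_subset)
qed simp

lemma finite_splittings [simp]: "finite {(A, B). A + B = (M :: 'a multiset)}"
  by (rule finite_subset [of _ "{A. A \<subseteq># M} \<times> {A. A \<subseteq># M}"])
     (auto simp: finite_submultisets)

lemma sum_splittings_empty:
  fixes g :: "'a multiset \<Rightarrow> rat"
  shows "(\<Sum>(A, B) | A + B = M. (if A = {#} then 1 else 0) * g B) = g M"
proof -
  have "(\<Sum>(A, B) | A + B = M. (if A = {#} then 1 else 0) * g B) =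
      (\<Sum>(A, B)\<in>{({#} :: 'a multiset, M)}. (if A = {#} then 1 else 0) * g B)"
    by (rule sum.mono_neutral_right) (auto split: if_splits)
  then show ?thesis by simp
qed

instantiation mseries :: comm_ring_1
begin
definition zero_mseries where "0 = Mseries (\<lambda>M. 0)"
definition one_mseries where "1 = Mseries (\<lambda>M. if M = {#} then 1 else 0)"
definition plus_mseries where "f + g = Mseries (\<lambda>M. coeff f M + coeff g M)"
definition uminus_mseries where "- f = Mseries (\<lambda>M. - coeff f M)"
definition minus_mseries where "f - g = Mseries (\<lambda>M. coeff f M - coeff g M)"
definition times_mseries where
  "f * g = Mseries (\<lambda>M. \<Sum>(A, B) | A + B = M. coeff f A * coeff g B)"

instance
proof
  fix f g h :: mseries
  show "f * g * h = f * (g * h)"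
  proof (rule mseries_eqI)
    fix M
    let ?t = "\<lambda>(A, B, C). coeff f A * coeff g B * coeff h C"
    have "coeff (f * g * h) M =
      (\<Sum>(E, C) | E + C = M. \<Sum>(A, B) | A + B = E. coeff f A * coeff g B * coeff h C)"
      by (simp add: times_mseries_def sum_distrib_right case_prod_beta)
    also have "\<dots> = (\<Sum>((E, C), (A, B)) \<in> (SIGMA p:{(E, C). E + C = M}. {(A, B). A + B = fst p}).
        coeff f A * coeff g B * coeff h C)"
      by (subst sum.Sigma [symmetric]) (auto simp: case_prod_beta)
    also have "\<dots> = sum ?t {(A, B, C). A + B + C = M}"
      by (rule sum.reindex_bij_witness [where i = "\<lambda>(A, B, C). ((A + B, C), (A, B))"
            and j = "\<lambda>((E, C), (A, B)). (A, B, C)"]) auto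
    also have "\<dots> = (\<Sum>((A, E), (B, C)) \<in> (SIGMA p:{(A, E). A + E = M}. {(B, C). B + C = snd p}).
        coeff f A * coeff g B * coeff h C)"
      by (rule sum.reindex_bij_witness [where j = "\<lambda>(A, B, C). ((A, B + C), (B, C))"
            and i = "\<lambda>((A, E), (B, C)). (A, B, C)"]) (auto simp: add.assoc)
    also have "\<dots> = (\<Sum>(A, E) | A + E = M. \<Sum>(B, C) | B + C = E. coeff f A * coeff g B * coeff h C)"
      by (subst sum.Sigma [symmetric]) (auto simp: case_prod_beta)
    also have "\<dots> = coeff (f * (g * h)) M"
      by (simp add: times_mseries_def sum_distrib_left case_prod_beta mult.assoc)
    finally show "coeff (f * g * h) M = coeff (f * (g * h)) M" .
  qed
  show "f * g = g * f"
  proof (rule mseries_eqI)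
    fix M
    show "coeff (f * g) M = coeff (g * f) M"
      unfolding times_mseries_def coeff_Mseries
      by (rule sum.reindex_bij_witness [where i = prod.swap and j = prod.swap])
         (auto simp: add.commute)
  qed
  show "1 * f = f"
  proof (rule mseries_eqI)
    fix M
    show "coeff (1 * f) M = coeff f M"
      by (simp add: times_mseries_def one_mseries_def sum_splittings_empty)
  qed
  show "(f + g) * h = f * h + g * h"
    by (rule mseries_eqI)
       (simp add: times_mseries_def plus_mseries_def ring_distribs sum.distrib case_prod_beta)
  show "(0::mseries) \<noteq> 1"
    by (auto simp: zero_mseries_def one_mseries_def Mseries_inject fun_eq_iff)
qed (rule mseries_eqI;
     simp add: plus_mseries_def zero_mseries_def uminus_mseries_def minus_mseries_def)+

end

lemma coeff_0 [simp]: "coeff 0 M = 0"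
  and coeff_1: "coeff 1 M = (if M = {#} then 1 else 0)"
  and coeff_add [simp]: "coeff (f + g) M = coeff f M + coeff g M"
  and coeff_uminus [simp]: "coeff (- f) M = - coeff f M"
  and coeff_diff [simp]: "coeff (f - g) M = coeff f M - coeff g M"
  and coeff_mult: "coeff (f * g) M = (\<Sum>(A, B) | A + B = M. coeff f A * coeff g B)"
  by (simp_all add: zero_mseries_def one_mseries_def plus_mseries_def uminus_mseries_def
      minus_mseries_def times_mseries_def)

lemma coeff_sum [simp]: "coeff (sum f S) M = (\<Sum>s\<in>S. coeff (f s) M)"
  by (induction S rule: infinite_finite_induct) auto

definition const :: "rat \<Rightarrow> mseries" where
  "const c = Mseries (mfps_const c)"

definition scale :: "rat \<Rightarrow> mseries \<Rightarrow> mseries" where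
  "scale c f = Mseries (\<lambda>M. c * coeff f M)"

lemma coeff_scale [simp]: "coeff (scale c f) M = c * coeff f M"
  by (simp add: scale_def)

global_interpretation mseries: vector_space scale
  by unfold_locales (auto intro!: mseries_eqI simp: algebra_simps)

lemma scale_mult_left: "scale c f * g = scale c (f * g)"
  by (rule mseries_eqI) (simp add: coeff_mult sum_distrib_left case_prod_beta mult.assoc)

lemma scale_mult_right: "f * scale c g = scale c (f * g)"
  using scale_mult_left [of c g f] by (simp add: mult.commute)

lemma const_eq_scale: "const c = scale c 1"
  by (rule mseries_eqI) (simp add: const_def mfps_const_def coeff_1)

lemma scale_eq_const_mult: "scale c f = const c * f"
  by (simp add: const_eq_scale scale_mult_left)

section \<open>Independent families and triangular changes of family\<close>

text \<open>
Independence is a property of families rather than of sets, so that it includes injectivity.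
\<close>

definition indep_family :: "('i \<Rightarrow> mseries) \<Rightarrow> 'i set \<Rightarrow> bool" where
  "indep_family b I \<longleftrightarrow>
     (\<forall>S c. finite S \<and> S \<subseteq> I \<and> (\<Sum>i\<in>S. scale (c i) (b i)) = 0 \<longrightarrow> (\<forall>i\<in>S. c i = 0))"

lemma span_image_obtain:
  assumes "x \<in> mseries.span (b ` J)"
  obtains S c where "finite S" "S \<subseteq> J" "x = (\<Sum>i\<in>S. scale (c i) (b i))"
proof -
  have "\<exists>S c. finite S \<and> S \<subseteq> J \<and> x = (\<Sum>i\<in>S. scale (c i) (b i))"
    using assms
  proof (induction rule: mseries.span_induct_alt)
    case base
    show ?case by (rule exI [of _ "{}"]) auto
  next
    case (step a y z)
    then obtain j S c where j: "j \<in> J" "y = b j" and S: "finite S" "S \<subseteq> J"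
      and z: "z = (\<Sum>i\<in>S. scale (c i) (b i))" by auto
    show ?case
    proof (cases "j \<in> S")
      case True
      let ?c = "c(j := c j + a)"
      have "(\<Sum>i\<in>S. scale (?c i) (b i)) = scale (c j + a) (b j) + (\<Sum>i\<in>S - {j}. scale (c i) (b i))"
        using S True by (subst sum.remove [of S j]) auto
      also have "\<dots> = scale a y + z"
        using S True unfolding z j(2)
        by (subst sum.remove [of S j]) (auto simp: mseries.scale_left_distrib)
      finally show ?thesis using S by metis
    next
      case False
      let ?c = "c(j := a)"
      have "(\<Sum>i\<in>insert j S. scale (?c i) (b i)) = scale a y + z"
        using S False unfolding z j(2) by (auto intro!: sum.cong)
      then show ?thesis using S j by (metis finite_insert insert_subset)
    qed
  qed
  then show thesis using that by blast
qed

text \<open>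
Independence says that spans of disjoint subfamilies meet in zero; this is the form in which it
gets used.
\<close>

lemma indep_family_disjoint:
  assumes "indep_family b I" "finite S" "S \<subseteq> I" "J \<subseteq> I" "S \<inter> J = {}"
    and "(\<Sum>i\<in>S. scale (c i) (b i)) \<in> mseries.span (b ` J)" "i \<in> S"
  shows "c i = 0"
proof -
  obtain T d where T: "finite T" "T \<subseteq> J"
    and eq: "(\<Sum>i\<in>S. scale (c i) (b i)) = (\<Sum>i\<in>T. scale (d i) (b i))"
    using span_image_obtain [OF assms(6)] .
  let ?e = "\<lambda>i. if i \<in> S then c i else - d i"
  have disj: "S \<inter> T = {}" using T assms(5) by auto
  have "(\<Sum>i\<in>S \<union> T. scale (?e i) (b i)) = (\<Sum>i\<in>S. scale (?e i) (b i)) + (\<Sum>i\<in>T. scale (?e i) (b i))"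
    using T assms(2) disj by (intro sum.union_disjoint) auto
  also have "(\<Sum>i\<in>S. scale (?e i) (b i)) = (\<Sum>i\<in>S. scale (c i) (b i))"
    by (rule sum.cong) auto
  also have "(\<Sum>i\<in>T. scale (?e i) (b i)) = - (\<Sum>i\<in>T. scale (d i) (b i))"
    using disj by (subst sum_negf [symmetric], intro sum.cong) auto
  finally have "(\<Sum>i\<in>S \<union> T. scale (?e i) (b i)) = 0" using eq by simp
  then have "\<forall>i\<in>S \<union> T. ?e i = 0"
    using assms(1) unfolding indep_family_def
    by (elim allE [of _ "S \<union> T"] allE [of _ ?e] impE) (use T assms(2-4) in auto)
  then have "?e i = 0" using assms(7) by blast
  then show ?thesis using assms(7) by simp
qed

definition monomial :: "('i \<Rightarrow> mseries) \<Rightarrow> 'i multiset \<Rightarrow> mseries" where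
  "monomial b \<alpha> = prod_mset (image_mset b \<alpha>)"

definition weight :: "('i \<Rightarrow> nat) \<Rightarrow> 'i multiset \<Rightarrow> nat" where
  "weight w \<alpha> = sum_mset (image_mset w \<alpha>)"

definition msets :: "'i set \<Rightarrow> 'i multiset set" where
  "msets X = {\<alpha>. set_mset \<alpha> \<subseteq> X}"

definition lower :: "('i \<Rightarrow> mseries) \<Rightarrow> ('i \<Rightarrow> nat) \<Rightarrow> 'i set \<Rightarrow> nat \<Rightarrow> mseries set" where
  "lower b w X n = mseries.span (monomial b ` {\<alpha> \<in> msets X. weight w \<alpha> < n})"

text \<open>
The element \<open>g\<close> is a non-zero multiple of the monomial \<open>\<alpha>\<close> in the elements \<open>b\<close> up to monomials of
smaller weight. The weight is only a natural number and not a monomial order: several monomials may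
have the same weight, but only one of them may occur in top weight.
\<close>

definition has_lead :: "('i \<Rightarrow> mseries) \<Rightarrow> ('i \<Rightarrow> nat) \<Rightarrow> 'i set \<Rightarrow> mseries \<Rightarrow> 'i multiset \<Rightarrow> bool" where
  "has_lead b w X g \<alpha> \<longleftrightarrow> \<alpha> \<in> msets X \<and>
     (\<exists>c. c \<noteq> 0 \<and> g - scale c (monomial b \<alpha>) \<in> lower b w X (weight w \<alpha>))"

lemma monomial_empty [simp]: "monomial b {#} = 1"
  and monomial_add_mset [simp]: "monomial b (add_mset i \<alpha>) = b i * monomial b \<alpha>"
  and monomial_union: "monomial b (\<alpha> + \<beta>) = monomial b \<alpha> * monomial b \<beta>"
  by (simp_all add: monomial_def)

lemma weight_empty [simp]: "weight w {#} = 0"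
  and weight_add_mset [simp]: "weight w (add_mset i \<alpha>) = w i + weight w \<alpha>"
  and weight_union [simp]: "weight w (\<alpha> + \<beta>) = weight w \<alpha> + weight w \<beta>"
  by (simp_all add: weight_def)

lemma msets_union [simp]: "\<alpha> + \<beta> \<in> msets X \<longleftrightarrow> \<alpha> \<in> msets X \<and> \<beta> \<in> msets X"
  and msets_empty [simp]: "{#} \<in> msets X"
  and msets_add_mset [simp]: "add_mset i \<alpha> \<in> msets X \<longleftrightarrow> i \<in> X \<and> \<alpha> \<in> msets X"
  by (auto simp: msets_def)

lemma span_mult:
  assumes "f \<in> mseries.span A" "g \<in> mseries.span B"
    and AB: "\<And>x y. x \<in> A \<Longrightarrow> y \<in> B \<Longrightarrow> x * y \<in> mseries.span C"
  shows "f * g \<in> mseries.span C"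
  using assms(1)
proof (induction rule: mseries.span_induct_alt)
  case base
  show ?case by (simp add: mseries.span_zero)
next
  case (step c x z)
  have "x * g \<in> mseries.span C"
    using assms(2)
  proof (induction rule: mseries.span_induct_alt)
    case base
    show ?case by (simp add: mseries.span_zero)
  next
    case (step c y z)
    then show ?case using AB [OF \<open>x \<in> A\<close>]
      by (auto simp: distrib_left scale_mult_right intro: mseries.span_add mseries.span_scale)
  qed
  with step show ?case
    by (auto simp: distrib_right scale_mult_left intro: mseries.span_add mseries.span_scale)
qed

text \<open>
Weights are additive on products, so the error terms of the factors only contribute to products of
smaller weight. This is why leading terms of generators determine those of all their products.
\<close>

lemma has_lead_mult:
  assumes "has_lead b w X f \<alpha>" "has_lead b w X g \<beta>"
  shows "has_lead b w X (f * g) (\<alpha> + \<beta>)"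
proof -
  from assms obtain c d where c: "c \<noteq> 0" "f - scale c (monomial b \<alpha>) \<in> lower b w X (weight w \<alpha>)"
    and d: "d \<noteq> 0" "g - scale d (monomial b \<beta>) \<in> lower b w X (weight w \<beta>)"
    and ab: "\<alpha> \<in> msets X" "\<beta> \<in> msets X"
    by (auto simp: has_lead_def)
  define u v where "u = f - scale c (monomial b \<alpha>)" and "v = g - scale d (monomial b \<beta>)"
  let ?L = "lower b w X (weight w (\<alpha> + \<beta>))"
  have "u * monomial b \<beta> \<in> ?L"
    unfolding lower_def
    by (rule span_mult [of _ "monomial b ` {\<gamma> \<in> msets X. weight w \<gamma> < weight w \<alpha>}" _
        "{monomial b \<beta>}"])
       (use c ab in \<open>auto simp: u_def lower_def monomial_union [symmetric] mseries.span_base intro!: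
           mseries.span_base imageI\<close>)
  moreover have "monomial b \<alpha> * v \<in> ?L"
    unfolding lower_def
    by (rule span_mult [of _ "{monomial b \<alpha>}" _ "monomial b ` {\<gamma> \<in> msets X. weight w \<gamma> <
        weight w \<beta>}"])
       (use d ab in \<open>auto simp: v_def lower_def monomial_union [symmetric] mseries.span_base intro!:
           mseries.span_base imageI\<close>)
  moreover have "u * v \<in> ?L"
    unfolding lower_def
    by (rule span_mult [of _ "monomial b ` {\<gamma> \<in> msets X. weight w \<gamma> < weight w \<alpha>}"
          _ "monomial b ` {\<gamma> \<in> msets X. weight w \<gamma> < weight w \<beta>}"])
       (use c d in \<open>auto simp: u_def v_def lower_def monomial_union [symmetric] intro!:
           mseries.span_base imageI\<close>)
  ultimately have "scale d (u * monomial b \<beta>) + scale c (monomial b \<alpha> * v) + u * v \<in> ?L"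
    unfolding lower_def by (intro mseries.span_add mseries.span_scale)
  moreover have "f * g - scale (c * d) (monomial b (\<alpha> + \<beta>)) = scale d (u * monomial b \<beta>) +
      scale c (monomial b \<alpha> * v) + u * v"
    by (simp add: u_def v_def monomial_union scale_mult_left scale_mult_right algebra_simps
        mseries.scale_right_diff_distrib)
  ultimately show ?thesis
    using c(1) d(1) ab unfolding has_lead_def by (auto intro!: exI [of _ "c * d"])
qed

lemma has_lead_monomial [simp]: "\<alpha> \<in> msets X \<Longrightarrow> has_lead b w X (monomial b \<alpha>) \<alpha>"
  unfolding has_lead_def lower_def by (auto intro!: exI [of _ 1] mseries.span_zero)

lemma lower_mono: "m \<le> n \<Longrightarrow> lower b w X m \<subseteq> lower b w X n"
  unfolding lower_def by (rule mseries.span_mono) auto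

lemma has_lead_imp_lower:
  assumes "has_lead b w X g \<alpha>" "weight w \<alpha> < n"
  shows "g \<in> lower b w X n"
proof -
  obtain c where c: "\<alpha> \<in> msets X" "g - scale c (monomial b \<alpha>) \<in> lower b w X (weight w \<alpha>)"
    using assms by (auto simp: has_lead_def)
  have "(g - scale c (monomial b \<alpha>)) + scale c (monomial b \<alpha>) \<in> lower b w X n"
    using c assms lower_mono [of "weight w \<alpha>" n b w X] unfolding lower_def
    by (intro mseries.span_add mseries.span_scale) (auto intro: mseries.span_base)
  then show ?thesis by (simp only: diff_add_cancel)
qed

lemma has_lead_prod:
  assumes "\<And>j. j \<in># \<beta> \<Longrightarrow> has_lead b w X (g j) (e j)"
  shows "has_lead b w X (monomial g \<beta>) (\<Sum>j\<in>#\<beta>. e j)"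
  using assms
proof (induction \<beta>)
  case empty
  then show ?case using has_lead_monomial [of "{#}" X b w] by simp
next
  case (add j \<beta>)
  then show ?case using has_lead_mult [of b w X "g j" "e j" "monomial g \<beta>" "\<Sum>j\<in>#\<beta>. e j"] by simp
qed

text \<open>
A triangular matrix with non-zero diagonal is injective. In a vanishing combination, consider the indices of maximal
weight: their leading monomials cannot be cancelled by anything else, because all other
contributions have smaller weight.
\<close>

lemma indep_family_has_lead:
  assumes indep: "indep_family (monomial b) (msets X)"
    and lead: "\<And>\<alpha>. \<alpha> \<in> msets X \<Longrightarrow> has_lead b w X (g \<alpha>) \<alpha>"
  shows "indep_family g (msets X)"
  unfolding indep_family_def
proof (intro allI impI)
  fix S c assume "finite S \<and> S \<subseteq> msets X \<and> (\<Sum>\<alpha>\<in>S. scale (c \<alpha>) (g \<alpha>)) = 0"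
  then have S: "finite S" "S \<subseteq> msets X" and sum0: "(\<Sum>\<alpha>\<in>S. scale (c \<alpha>) (g \<alpha>)) = 0" by auto
  show "\<forall>\<alpha>\<in>S. c \<alpha> = 0"
  proof (rule ccontr)
    assume "\<not> (\<forall>\<alpha>\<in>S. c \<alpha> = 0)"
    \<comment> \<open>the set \<open>U\<close> below consists of the indices of maximal weight with non-zero coefficient\<close>
    define T where "T = {\<alpha> \<in> S. c \<alpha> \<noteq> 0}"
    define n where "n = Max (weight w ` T)"
    have T: "finite T" "T \<noteq> {}" "T \<subseteq> msets X"
      using S \<open>\<not> (\<forall>\<alpha>\<in>S. c \<alpha> = 0)\<close> by (auto simp: T_def)
    define U where "U = {\<alpha> \<in> T. weight w \<alpha> = n}"
    have "n \<in> weight w ` T" unfolding n_def using T by (intro Max_in) auto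
    then obtain \<alpha>0 where \<alpha>0: "\<alpha>0 \<in> U" by (auto simp: U_def)
    have le: "weight w \<alpha> \<le> n" if "\<alpha> \<in> T" for \<alpha>
      unfolding n_def using T that by auto
    have sumT: "(\<Sum>\<alpha>\<in>T. scale (c \<alpha>) (g \<alpha>)) = 0"
      unfolding T_def using S sum0 by (subst sum.mono_neutral_left [of S]) auto
    have "\<forall>\<alpha>\<in>T. \<exists>d. d \<noteq> 0 \<and> g \<alpha> - scale d (monomial b \<alpha>) \<in> lower b w X (weight w \<alpha>)"
      using lead T by (auto simp: has_lead_def)
    then obtain d where d: "\<And>\<alpha>. \<alpha> \<in> T \<Longrightarrow> d \<alpha> \<noteq> 0"
      "\<And>\<alpha>. \<alpha> \<in> T \<Longrightarrow> g \<alpha> - scale (d \<alpha>) (monomial b \<alpha>) \<in> lower b w X (weight w \<alpha>)"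
      by metis
    have 1: "scale (c \<alpha>) (g \<alpha>) - (if \<alpha> \<in> U then scale (c \<alpha> * d \<alpha>) (monomial b \<alpha>) else 0) \<in>
        lower b w X n"
      if "\<alpha> \<in> T" for \<alpha>
    proof -
      have eq: "scale (c \<alpha>) (g \<alpha>) = scale (c \<alpha>) (g \<alpha> - scale (d \<alpha>) (monomial b \<alpha>)) +
          scale (c \<alpha> * d \<alpha>) (monomial b \<alpha>)"
        by (simp add: mseries.scale_right_diff_distrib)
      have 2: "scale (c \<alpha>) (g \<alpha> - scale (d \<alpha>) (monomial b \<alpha>)) \<in> lower b w X n"
        using d(2) [OF that] lower_mono [OF le [OF that], of b w X] unfolding lower_def
        by (blast intro: mseries.span_scale)
      show ?thesis
      proof (cases "\<alpha> \<in> U")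
        case True
        then show ?thesis using 2 eq by simp
      next
        case False
        then have "weight w \<alpha> < n" using le [OF that] that by (auto simp: U_def)
        then have "monomial b \<alpha> \<in> lower b w X n" unfolding lower_def
          using T that by (intro mseries.span_base) auto
        then show ?thesis using 2 eq False unfolding lower_def
          by (auto intro: mseries.span_add mseries.span_scale)
      qed
    qed
    have "(\<Sum>\<alpha>\<in>T. scale (c \<alpha>) (g \<alpha>) - (if \<alpha> \<in> U then scale (c \<alpha> * d \<alpha>) (monomial b \<alpha>) else 0)) \<in>
        lower b w X n"
      using 1 unfolding lower_def by (rule mseries.span_sum)
    moreover have "(\<Sum>\<alpha>\<in>T. if \<alpha> \<in> U then scale (c \<alpha> * d \<alpha>) (monomial b \<alpha>) else 0) =
        (\<Sum>\<alpha>\<in>U. scale (c \<alpha> * d \<alpha>) (monomial b \<alpha>))"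
      using T by (intro sum.mono_neutral_cong_right) (auto simp: U_def)
    ultimately have "- (\<Sum>\<alpha>\<in>U. scale (c \<alpha> * d \<alpha>) (monomial b \<alpha>)) \<in> lower b w X n"
      using sumT by (simp add: sum_subtractf)
    then have "(\<Sum>\<alpha>\<in>U. scale (c \<alpha> * d \<alpha>) (monomial b \<alpha>)) \<in> lower b w X n"
      unfolding lower_def using mseries.span_neg by fastforce
    then have "c \<alpha>0 * d \<alpha>0 = 0"
      unfolding lower_def
      by (intro indep_family_disjoint [OF indep, of U "{\<alpha> \<in> msets X. weight w \<alpha> < n}"])
         (use T \<alpha>0 in \<open>auto simp: U_def\<close>)
    then show False using d \<alpha>0 by (auto simp: U_def T_def)
  qed
qed

text \<open>
A triangular matrix with non-zero diagonal is surjective, by induction on the weight.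
\<close>

lemma span_has_lead:
  assumes lead: "\<And>\<alpha>. \<alpha> \<in> msets X \<Longrightarrow> has_lead b w X (g \<alpha>) \<alpha>"
  shows "mseries.span (g ` msets X) = mseries.span (monomial b ` msets X)"
proof -
  have "monomial b \<alpha> \<in> mseries.span (g ` msets X)" if "\<alpha> \<in> msets X" for \<alpha>
    using that
  proof (induction "weight w \<alpha>" arbitrary: \<alpha> rule: less_induct)
    case less
    obtain c where c: "c \<noteq> 0" "g \<alpha> - scale c (monomial b \<alpha>) \<in> lower b w X (weight w \<alpha>)"
      using lead [OF less.prems] by (auto simp: has_lead_def)
    have "lower b w X (weight w \<alpha>) \<subseteq> mseries.span (g ` msets X)"
      unfolding lower_def using less.hyps
        by (intro mseries.span_minimal) (auto simp: mseries.subspace_span)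
    then have "g \<alpha> - scale c (monomial b \<alpha>) \<in> mseries.span (g ` msets X)"
      using c by blast
    then have "g \<alpha> - (g \<alpha> - scale c (monomial b \<alpha>)) \<in> mseries.span (g ` msets X)"
      using less.prems by (metis imageI mseries.span_base mseries.span_diff)
    then have "scale c (monomial b \<alpha>) \<in> mseries.span (g ` msets X)"
      by simp
    then have "scale (1 / c) (scale c (monomial b \<alpha>)) \<in> mseries.span (g ` msets X)"
      by (rule mseries.span_scale)
    then show ?case using c by simp
  qed
  moreover have "g \<alpha> \<in> mseries.span (monomial b ` msets X)" if \<alpha>: "\<alpha> \<in> msets X" for \<alpha>
  proof -
    obtain c where c: "c \<noteq> 0" "g \<alpha> - scale c (monomial b \<alpha>) \<in> lower b w X (weight w \<alpha>)"
      using lead [OF \<alpha>] by (auto simp: has_lead_def)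
    have "lower b w X (weight w \<alpha>) \<subseteq> mseries.span (monomial b ` msets X)"
      unfolding lower_def by (intro mseries.span_mono) auto
    then have "g \<alpha> - scale c (monomial b \<alpha>) \<in> mseries.span (monomial b ` msets X)"
      using c by blast
    moreover have "scale c (monomial b \<alpha>) \<in> mseries.span (monomial b ` msets X)"
      using \<alpha> by (simp add: mseries.span_base mseries.span_scale)
    ultimately have "(g \<alpha> - scale c (monomial b \<alpha>)) + scale c (monomial b \<alpha>) \<in>
        mseries.span (monomial b ` msets X)"
      by (rule mseries.span_add)
    then show ?thesis by (simp only: diff_add_cancel)
  qed
  ultimately show ?thesis
    by (intro subset_antisym mseries.span_minimal image_subsetI mseries.subspace_span)
qed

section \<open>Algebraic independence of the complete homogeneous functions\<close>

definition hsym :: "nat \<Rightarrow> mseries" where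
  "hsym n = Mseries (complete_hom n)"

definition psum :: "nat \<Rightarrow> mseries" where
  "psum n = Mseries (\<lambda>M. if \<exists>i. M = replicate_mset n i then 1 else 0)"

lemma coeff_hsym [simp]: "coeff (hsym n) M = (if size M = n then 1 else 0)"
  by (simp add: hsym_def complete_hom_def)

lemma coeff_psum [simp]: "coeff (psum n) M = (if \<exists>i. M = replicate_mset n i then 1 else 0)"
  by (simp add: psum_def)

lemma hsym_0 [simp]: "hsym 0 = 1"
  by (rule mseries_eqI) (simp add: coeff_1)

text \<open>
The exponents of a monomial in the variables, with the variables forgotten.
\<close>

definition shape :: "nat multiset \<Rightarrow> nat multiset" where
  "shape M = image_mset (count M) (mset_set (set_mset M))"

lemma size_shape: "size (shape M) = card (set_mset M)"
  by (simp add: shape_def)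

lemma shape_replicate_plus:
  assumes "i \<notin># B" "n > 0"
  shows "shape (replicate_mset n i + B) = add_mset n (shape B)"
proof -
  have "set_mset (replicate_mset n i + B) = insert i (set_mset B)" using assms by auto
  then have "shape (replicate_mset n i + B) =
      image_mset (count (replicate_mset n i + B)) (add_mset i (mset_set (set_mset B)))"
    using assms by (simp add: shape_def)
  also have "\<dots> = add_mset n (image_mset (count (replicate_mset n i + B)) (mset_set (set_mset B)))"
    using assms by (simp add: not_in_iff)
  also have "image_mset (count (replicate_mset n i + B)) (mset_set (set_mset B)) = shape B"
    unfolding shape_def using assms by (intro image_mset_cong) auto
  finally show ?thesis .
qed

lemma coeff_monomial_psum_nonneg: "coeff (monomial psum \<delta>) M \<ge> 0"
  by (induction \<delta> arbitrary: M) (auto simp: coeff_1 coeff_mult intro!: sum_nonneg)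

text \<open>
A monomial of a product of power sums is a product of powers of single variables, one for each factor.
It involves fewer variables than there are factors if some of these variables coincide; otherwise
its exponents are the indices of the power sums.
\<close>

lemma coeff_monomial_psum_nonzero:
  assumes "\<delta> \<in> msets {1..}" "coeff (monomial psum \<delta>) M \<noteq> 0"
  shows "card (set_mset M) \<le> size \<delta>" "card (set_mset M) = size \<delta> \<Longrightarrow> shape M = \<delta>"
proof -
  have "card (set_mset M) \<le> size \<delta> \<and> (card (set_mset M) = size \<delta> \<longrightarrow> shape M = \<delta>)"
    using assms
  proof (induction \<delta> arbitrary: M)
    case empty
    then show ?case by (auto simp: coeff_1 shape_def split: if_splits)
  next
    case (add n \<delta>)
    have "(\<Sum>(A, B) | A + B = M. coeff (psum n) A * coeff (monomial psum \<delta>) B) \<noteq> 0"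
      using add.prems by (simp only: monomial_add_mset coeff_mult) simp
    then obtain A B where AB: "A + B = M" "coeff (psum n) A * coeff (monomial psum \<delta>) B \<noteq> 0"
      by (auto elim!: sum.not_neutral_contains_not_neutral)
    then obtain i where i: "A = replicate_mset n i" by (auto split: if_splits)
    have IH: "card (set_mset B) \<le> size \<delta>" "card (set_mset B) = size \<delta> \<Longrightarrow> shape B = \<delta>"
      using add.IH [of B] add.prems AB by auto
    have n: "n > 0" using add.prems by auto
    have M: "set_mset M = insert i (set_mset B)" using AB i n by auto
    show ?case
    proof (cases "i \<in># B")
      case True
      then show ?thesis using M IH by (simp add: insert_absorb)
    next
      case False
      then show ?thesis using M IH shape_replicate_plus [OF False n] AB i by auto
    qed
  qed
  then show "card (set_mset M) \<le> size \<delta>" "card (set_mset M) = size \<delta> \<Longrightarrow> shape M = \<delta>" by auto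
qed

lemma coeff_monomial_psum_pos:
  assumes "\<gamma> \<in> msets {1..}"
  shows "\<exists>M. shape M = \<gamma> \<and> coeff (monomial psum \<gamma>) M > 0"
  using assms
proof (induction \<gamma>)
  case empty
  show ?case by (rule exI [of _ "{#}"]) (simp add: shape_def coeff_1)
next
  case (add n \<gamma>)
  then obtain B where B: "shape B = \<gamma>" "coeff (monomial psum \<gamma>) B > 0" by auto
  have n: "n > 0" using add.prems by auto
  obtain i where i: "i \<notin># B" using ex_new_if_finite [of "set_mset B"] by auto
  let ?M = "replicate_mset n i + B"
  let ?t = "\<lambda>(A, B). coeff (psum n) A * coeff (monomial psum \<gamma>) B"
  have "coeff (monomial psum (add_mset n \<gamma>)) ?M = sum ?t {(A, B). A + B = ?M}"
    by (simp only: monomial_add_mset coeff_mult)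
  moreover have "\<dots> \<ge> sum ?t {(replicate_mset n i, B)}"
    by (rule sum_mono2) (auto simp: coeff_monomial_psum_nonneg)
  moreover have "sum ?t {(replicate_mset n i, B)} > 0" using B by auto
  ultimately show ?case using shape_replicate_plus [OF i n] B by (intro exI [of _ ?M]) simp
qed

text \<open>
Take a product of power sums with a maximal number of factors among those that occur in a relation.
A monomial in pairwise different variables, with the indices of these factors as exponents, occurs
in no other product of the relation.
\<close>

lemma indep_family_psum: "indep_family (monomial psum) (msets {1..})"
  unfolding indep_family_def
proof (intro allI impI)
  fix S c assume "finite S \<and> S \<subseteq> msets {1..} \<and> (\<Sum>\<delta>\<in>S. scale (c \<delta>) (monomial psum \<delta>)) = 0"
  then have S: "finite S" "S \<subseteq> msets {1..}" and sum0: "(\<Sum>\<delta>\<in>S. scale (c \<delta>) (monomial psum \<delta>)) = 0"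
    by auto
  show "\<forall>\<delta>\<in>S. c \<delta> = 0"
  proof (rule ccontr)
    assume "\<not> (\<forall>\<delta>\<in>S. c \<delta> = 0)"
    then obtain \<gamma>' where "\<gamma>' \<in> S \<and> c \<gamma>' \<noteq> 0" by blast
    then obtain \<gamma> where \<gamma>: "\<gamma> \<in> S" "c \<gamma> \<noteq> 0" 
      and max: "\<And>\<delta>. \<delta> \<in> S \<Longrightarrow> c \<delta> \<noteq> 0 \<Longrightarrow> size \<delta> \<le> size \<gamma>"
      using ex_has_greatest_nat [of "\<lambda>\<delta>. \<delta> \<in> S \<and> c \<delta> \<noteq> 0" \<gamma>' size "Suc (Max (size ` S))"] S
      by (auto simp: less_Suc_eq_le)
    obtain M where M: "shape M = \<gamma>" "coeff (monomial psum \<gamma>) M > 0"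
      using coeff_monomial_psum_pos [of \<gamma>] \<gamma> S by auto
    have zero: "c \<delta> * coeff (monomial psum \<delta>) M = 0" if "\<delta> \<in> S - {\<gamma>}" for \<delta>
    proof (rule ccontr)
      assume nz: "c \<delta> * coeff (monomial psum \<delta>) M \<noteq> 0"
      then have "size \<delta> \<le> size \<gamma>" using max that by auto
      moreover have "size \<gamma> \<le> size \<delta>" and "size \<gamma> = size \<delta> \<Longrightarrow> \<gamma> = \<delta>"
        using coeff_monomial_psum_nonzero [of \<delta> M] nz that S M size_shape [of M] by auto
      ultimately show False using that by auto
    qed
    have "0 = coeff (\<Sum>\<delta>\<in>S. scale (c \<delta>) (monomial psum \<delta>)) M" using sum0 by simp
    also have "\<dots> = (\<Sum>\<delta>\<in>S. c \<delta> * coeff (monomial psum \<delta>) M)" by simp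
    also have "\<dots> = (\<Sum>\<delta>\<in>{\<gamma>}. c \<delta> * coeff (monomial psum \<delta>) M)"
      by (rule sum.mono_neutral_right) (use S \<gamma> zero in auto)
    finally show False using M \<gamma> by simp
  qed
qed

text \<open>
A monomial arises from this product once for each variable whose \<open>i\<close>-th power divides it.
\<close>

lemma coeff_psum_mult_hsym:
  assumes "i > 0"
  shows "coeff (psum i * hsym j) M =
    (if size M = i + j then of_nat (card {x \<in> set_mset M. i \<le> count M x}) else 0)"
proof -
  let ?P = "{(A, B). A + B = M \<and> (\<exists>x. A = replicate_mset i x) \<and> size B = j}"
  have "coeff (psum i * hsym j) M =
      (\<Sum>(A, B) | A + B = M. if (\<exists>x. A = replicate_mset i x) \<and> size B = j then 1 else 0)"
    unfolding coeff_mult by (rule sum.cong) auto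
  also have "\<dots> = (\<Sum>p\<in>?P. 1)"
    by (rule sum.mono_neutral_cong_right) (auto split: if_splits)
  also have "\<dots> = of_nat (card ?P)" by simp
  finally have 1: "coeff (psum i * hsym j) M = of_nat (card ?P)" .
  show ?thesis
  proof (cases "size M = i + j")
    case True
    have "bij_betw (\<lambda>x. (replicate_mset i x, M - replicate_mset i x)) {x \<in> set_mset M. i \<le>
        count M x} ?P"
    proof (rule bij_betwI')
      fix x y
      show "((replicate_mset i x, M - replicate_mset i x) =
          (replicate_mset i y, M - replicate_mset i y)) = (x = y)"
        using assms by (auto dest: arg_cong [of _ _ set_mset])
    next
      fix x assume "x \<in> {x \<in> set_mset M. i \<le> count M x}"
      then have "replicate_mset i x \<subseteq># M" by (simp add: count_le_replicate_mset_subset_eq)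
      then show "(replicate_mset i x, M - replicate_mset i x) \<in> ?P"
        using True by (auto simp: size_Diff_submset)
    next
      fix p assume "p \<in> ?P"
      then obtain x B where p: "p = (replicate_mset i x, B)" "M = replicate_mset i x + B" by auto
      show "\<exists>x\<in>{x \<in> set_mset M. i \<le> count M x}. p = (replicate_mset i x, M - replicate_mset i x)"
        using assms by (intro bexI [of _ x]) (auto simp: p)
    qed
    then show ?thesis using 1 True by (simp add: bij_betw_same_card)
  next
    case False
    then have "?P = {}" by auto
    then show ?thesis using 1 False by (simp only: card.empty) simp
  qed
qed

text \<open>
Summed over \<open>i\<close>, the numbers of variables whose \<open>i\<close>-th power divides a monomial give its degree.
\<close>

lemma Newton_identity: "scale (of_nat n) (hsym n) = (\<Sum>i=1..n. psum i * hsym (n - i))"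
proof (rule mseries_eqI)
  fix M
  show "coeff (scale (of_nat n) (hsym n)) M = coeff (\<Sum>i=1..n. psum i * hsym (n - i)) M"
  proof (cases "size M = n")
    case True
    have "coeff (\<Sum>i=1..n. psum i * hsym (n - i)) M =
        (\<Sum>i=1..n. of_nat (card {x \<in> set_mset M. i \<le> count M x}))"
      unfolding coeff_sum by (rule sum.cong) (auto simp: coeff_psum_mult_hsym True)
    also have "\<dots> = of_nat (\<Sum>i=1..n. card {x \<in> set_mset M. i \<le> count M x})" by simp
    also have "(\<Sum>i=1..n. card {x \<in> set_mset M. i \<le> count M x}) =
        (\<Sum>x\<in>set_mset M. card {i \<in> {1..n}. i \<le> count M x})"
      by (rule sum_multicount_gen) auto
    also have "\<dots> = (\<Sum>x\<in>set_mset M. count M x)"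
    proof (rule sum.cong)
      fix x
      have "{i \<in> {1..n}. i \<le> count M x} = {1..count M x}" using True count_le_size [of M x] by auto
      then show "card {i \<in> {1..n}. i \<le> count M x} = count M x" by simp
    qed simp
    also have "\<dots> = n" using True by (simp add: size_multiset_overloaded_eq)
    finally show ?thesis using True by simp
  next
    case False
    then show ?thesis by (auto simp: coeff_psum_mult_hsym intro!: sum.neutral)
  qed
qed

text \<open>
With the squares as weights, splitting an index into several parts lowers the weight, so that
Newton's identity makes \<open>p\<^sub>n / n\<close> the leading term of \<open>h\<^sub>n\<close>.
\<close>

lemma has_lead_hsym_psum:
  assumes "n > 0"
  shows "has_lead psum (\<lambda>i. i * i) {1..} (hsym n) {#n#}"
  using assms
proof (induction n rule: less_induct)
  case (less n)
  let ?L = "lower psum (\<lambda>i. i * i) {1..}"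
  have "psum i * hsym (n - i) \<in> ?L (n * n)" if i: "i \<in> {1..<n}" for i
  proof -
    have "hsym (n - i) \<in> ?L (Suc ((n - i) * (n - i)))"
      by (rule has_lead_imp_lower [OF less.IH]) (use i in auto)
    moreover have "psum i \<in> mseries.span {psum i}" by (simp add: mseries.span_base)
    moreover have "i * i + (n - i) * (n - i) < n * n"
    proof -
      obtain j where "n = i + j" "j > 0" using i by (metis atLeastLessThan_iff less_imp_add_positive)
      then show ?thesis using i by (auto simp: algebra_simps)
    qed
    ultimately show ?thesis
      unfolding lower_def
      by (elim span_mult) (use i in \<open>auto simp: less_Suc_eq_le simp flip: monomial_add_mset intro!:
          mseries.span_base imageI\<close>)
  qed
  then have "(\<Sum>i=1..<n. psum i * hsym (n - i)) \<in> ?L (n * n)"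
    unfolding lower_def by (rule mseries.span_sum)
  moreover have "scale (of_nat n) (hsym n) = psum n + (\<Sum>i=1..<n. psum i * hsym (n - i))"
    using less.prems unfolding Newton_identity
    by (subst sum.last_plus) auto
  then have "scale (1 / of_nat n) (scale (of_nat n) (hsym n)) =
      scale (1 / of_nat n) (psum n) + scale (1 / of_nat n) (\<Sum>i=1..<n. psum i * hsym (n - i))"
    by (simp only: mseries.scale_right_distrib)
  then have "hsym n - scale (1 / of_nat n) (monomial psum {#n#}) =
      scale (1 / of_nat n) (\<Sum>i=1..<n. psum i * hsym (n - i))"
    using less.prems by simp
  ultimately show ?case
    using less.prems unfolding has_lead_def lower_def
    by (auto intro!: exI [of _ "1 / of_nat n"] mseries.span_scale)
qed

lemma indep_family_hsym: "indep_family (monomial hsym) (msets {1..})"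
proof (rule indep_family_has_lead [OF indep_family_psum, of "\<lambda>i. i * i"])
  fix \<alpha> :: "nat multiset" assume "\<alpha> \<in> msets {1..}"
  then have "has_lead psum (\<lambda>i. i * i) {1..} (monomial hsym \<alpha>) (\<Sum>j\<in>#\<alpha>. {#j#})"
    by (intro has_lead_prod has_lead_hsym_psum) (auto simp: msets_def)
  then show "has_lead psum (\<lambda>i. i * i) {1..} (monomial hsym \<alpha>) \<alpha>" by simp
qed

section \<open>Determinants of complete homogeneous functions in finitely many variables\<close>

text \<open>
Setting all variables from \<open>x\<^sub>n\<close> on to zero.
\<close>

definition trunc :: "nat \<Rightarrow> mseries \<Rightarrow> mseries" where
  "trunc n f = Mseries (\<lambda>M. if set_mset M \<subseteq> {..<n} then coeff f M else 0)"

lemma coeff_trunc [simp]: "coeff (trunc n f) M = (if set_mset M \<subseteq> {..<n} then coeff f M else 0)"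
  by (simp add: trunc_def)

global_interpretation trunc: comm_ring_hom "trunc n" for n
proof
  fix f g
  show "trunc n 0 = 0" "trunc n 1 = 1" "trunc n (f + g) = trunc n f + trunc n g"
    by (rule mseries_eqI; simp add: coeff_1)+
  show "trunc n (f * g) = trunc n f * trunc n g"
  proof (rule mseries_eqI)
    fix M
    show "coeff (trunc n (f * g)) M = coeff (trunc n f * trunc n g) M"
    proof (cases "set_mset M \<subseteq> {..<n}")
      case True
      then show ?thesis by (auto simp: coeff_mult intro!: sum.cong)
    next
      case False
      have "(\<Sum>(A, B) | A + B = M. coeff (trunc n f) A * coeff (trunc n g) B) = 0"
        by (rule sum.neutral) (use False in auto)
      then show ?thesis unfolding coeff_mult [of "trunc n f"] using False by simp
    qed
  qed
qed

definition Var :: "nat \<Rightarrow> mseries" where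
  "Var n = Mseries (\<lambda>M. if M = {#n#} then 1 else 0)"

lemma coeff_Var_power_mult:
  "coeff (Var n ^ d * f) M = (if d \<le> count M n then coeff f (M - replicate_mset d n) else 0)"
proof (induction d arbitrary: M)
  case (Suc d)
  have mult: "coeff (Var n * g) M = (if n \<in># M then coeff g (M - {#n#}) else 0)" for g M
  proof -
    have "coeff (Var n * g) M = (\<Sum>(A, B) | A + B = M. if A = {#n#} then coeff g B else 0)"
      unfolding coeff_mult by (rule sum.cong) (auto simp: Var_def)
    also have "\<dots> = (\<Sum>(A, B) \<in> (if n \<in># M then {({#n#}, M - {#n#})} else {}). coeff g B)"
      by (rule sum.mono_neutral_cong_right) (auto split: if_splits)
    finally show ?thesis by simp
  qed
  have "coeff (Var n ^ Suc d * f) M = coeff (Var n * (Var n ^ d * f)) M" by (simp add: mult.assoc)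
  also have "\<dots> = (if Suc d \<le> count M n then coeff f (M - replicate_mset (Suc d) n) else 0)"
    unfolding mult Suc.IH by (auto simp: Suc_le_eq simp flip: count_greater_zero_iff)
  finally show ?case .
qed simp

text \<open>
Integer indices, since the entries of the Jacobi-Trudi matrix have indices of either sign.
\<close>

definition hz :: "int \<Rightarrow> mseries" where
  "hz r = (if r < 0 then 0 else hsym (nat r))"

lemma coeff_hz [simp]: "coeff (hz r) M = (if int (size M) = r then 1 else 0)"
  by (auto simp: hz_def)

lemma trunc_hz_Suc: "trunc (Suc n) (hz r) = trunc n (hz r) + Var n * trunc (Suc n) (hz (r - 1))"
proof (rule mseries_eqI)
  fix M
  have *: "set_mset M \<subseteq> {..<Suc n} \<longleftrightarrow> set_mset M \<subseteq> {..<n}" if "n \<notin># M"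
    using that by (auto simp: less_Suc_eq)
  have V: "coeff (Var n * f) M = (if n \<in># M then coeff f (M - {#n#}) else 0)" for f
    using coeff_Var_power_mult [of n 1 f M] by (simp add: Suc_le_eq)
  show "coeff (trunc (Suc n) (hz r)) M =
      coeff (trunc n (hz r) + Var n * trunc (Suc n) (hz (r - 1))) M"
  proof (cases "n \<in># M")
    case True
    then obtain N where "M = add_mset n N" by (metis multi_member_split)
    then have "coeff (trunc (Suc n) (hz r)) M = coeff (trunc (Suc n) (hz (r - 1))) N"
      and "coeff (trunc n (hz r)) M = 0" by auto
    moreover have "coeff (Var n * trunc (Suc n) (hz (r - 1))) M =
        coeff (trunc (Suc n) (hz (r - 1))) N"
      using V True \<open>M = add_mset n N\<close> by simp
    ultimately show ?thesis by (simp only: coeff_add)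
  next
    case False
    then show ?thesis using * by (auto simp: V)
  qed
qed

text \<open>
The recursion in the number of variables, iterated \<open>d\<close> times. It is written for a difference of two
terms because that is what a row operation on the Jacobi-Trudi matrix produces.
\<close>

lemma trunc_hz_telescope:
  "trunc (Suc n) (hz (a + int d)) - Var n ^ d * trunc (Suc n) (hz a) =
   (\<Sum>b\<in>{a<..a + int d}. Var n ^ nat (a + int d - b) * trunc n (hz b))"
proof (induction d)
  case (Suc d)
  have eq: "{a<..a + int (Suc d)} = insert (a + int (Suc d)) {a<..a + int d}" by auto
  have "(\<Sum>b\<in>{a<..a + int d}. Var n ^ nat (a + int (Suc d) - b) * trunc n (hz b)) =
      Var n * (\<Sum>b\<in>{a<..a + int d}. Var n ^ nat (a + int d - b) * trunc n (hz b))"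
    unfolding sum_distrib_left
  proof (rule sum.cong)
    fix b assume "b \<in> {a<..a + int d}"
    then have "nat (a + int (Suc d) - b) = Suc (nat (a + int d - b))" by auto
    then show "Var n ^ nat (a + int (Suc d) - b) * trunc n (hz b) =
        Var n * (Var n ^ nat (a + int d - b) * trunc n (hz b))" by (simp add: mult.assoc)
  qed simp
  also have "\<dots> = Var n * trunc (Suc n) (hz (a + int d)) - Var n ^ Suc d * trunc (Suc n) (hz a)"
    unfolding Suc.IH [symmetric] by (simp add: algebra_simps)
  finally show ?case
    unfolding eq using trunc_hz_Suc [of n "a + int (Suc d)"] by (simp add: algebra_simps)
qed simp

text \<open>
For a partition \<open>\<lambda>\<close> the matrix is taken at \<open>a i = \<lambda>\<^sub>i - i\<close>. In these coordinates the interlacing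
conditions become membership in disjoint half-open intervals.
\<close>

definition jt_mat :: "nat \<Rightarrow> (nat \<Rightarrow> int) \<Rightarrow> mseries mat" where
  "jt_mat m a = mat m m (\<lambda>(i, j). hz (a i + int j))"

definition jt_det :: "nat \<Rightarrow> nat \<Rightarrow> (nat \<Rightarrow> int) \<Rightarrow> mseries" where
  "jt_det n m a = trunc n (det (jt_mat m a))"

lemma jt_det_leibniz:
  "jt_det n m a =
    (\<Sum>p | p permutes {0..<m}. signof p * (\<Prod>i=0..<m. trunc n (hz (a i + int (p i)))))"
proof -
  have perm: "p i < m" if "p permutes {0..<m}" "i < m" for p i
    using permutes_in_image [OF that(1), of i] that by simp
  have "jt_det n m a = det (map_mat (trunc n) (jt_mat m a))"
    unfolding jt_det_def by (simp add: trunc.hom_det)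
  also have "\<dots> = (\<Sum>p | p permutes {0..<m}. signof p * (\<Prod>i=0..<m. map_mat (trunc n) (jt_mat m a) $$
      (i, p i)))"
    by (rule det_def') (simp add: jt_mat_def)
  also have "\<dots> = (\<Sum>p | p permutes {0..<m}. signof p * (\<Prod>i=0..<m. trunc n (hz (a i + int (p i)))))"
    by (intro sum.cong arg_cong2 [of _ _ _ _ "(*)"] prod.cong) (auto simp: jt_mat_def perm)
  finally show ?thesis .
qed

text \<open>
Subtract from each row the next one, times the power of \<open>x\<^sub>n\<close> for which the terms telescope. The new
rows are sums of rows in the first \<open>n\<close> variables, over exactly the interlacing values, and the
determinant is expanded linearly in each row. The last row fits this scheme with a fictitious next
row at \<open>a m = - m\<close>, which has only negative indices and hence is zero.
\<close>

lemma jt_det_Suc: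
  assumes a: "\<And>i. i < m \<Longrightarrow> a (Suc i) \<le> a i" and am: "a m = - int m"
  shows "jt_det (Suc n) m a =
    (\<Sum>b \<in> PiE {0..<m} (\<lambda>i. {a (Suc i)<..a i}).
       (\<Prod>i=0..<m. Var n ^ nat (a i - b i)) * jt_det n m b)"
proof -
  have perm: "p i < m" if "p permutes {0..<m}" "i < m" for p i
    using permutes_in_image [OF that(1), of i] that by simp
  define x where "x i = Var n ^ nat (a i - a (Suc i))" for i
  define A where "A = map_mat (trunc (Suc n)) (jt_mat m a)"
  \<comment> \<open>left multiplication by \<open>U\<close> carries out all the row operations at once\<close>
  define U where "U = mat m m (\<lambda>(i, j). if j = i then 1 else if j = Suc i then -
      x i else (0 :: mseries))"
  have carr: "A \<in> carrier_mat m m" "U \<in> carrier_mat m m"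
    by (auto simp: A_def U_def jt_mat_def)
  have "det U = prod_list (diag_mat U)"
    by (rule det_upper_triangular [OF _ carr(2)]) (auto simp: U_def upper_triangular_def)
  also have "\<dots> = 1"
    by (simp add: prod_list_diag_prod U_def)
  finally have detU: "det U = 1" .
  have entry: "(U * A) $$ (i, j) = 
      (\<Sum>b\<in>{a (Suc i)<..a i}. Var n ^ nat (a i - b) * trunc n (hz (b + int j)))"
    if ij: "i < m" "j < m" for i j
  proof -
    have A_row: "A $$ (r, j) = trunc (Suc n) (hz (a r + int j))" if "r < m" for r
      using that ij by (simp add: A_def jt_mat_def)
    have "(U * A) $$ (i, j) = (\<Sum>r\<in>{0..<m}. U $$ (i, r) * A $$ (r, j))"
      using ij carr by (simp add: scalar_prod_def)
    also have "\<dots> = (\<Sum>r\<in>{0..<m} \<inter> {i, Suc i}. U $$ (i, r) * A $$ (r, j))"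
      by (rule sum.mono_neutral_right) (use ij in \<open>auto simp: U_def\<close>)
    also have "\<dots> = trunc (Suc n) (hz (a i + int j)) - x i * trunc (Suc n) (hz (a (Suc i) + int j))"
    proof (cases "Suc i < m")
      case True
      then have "{0..<m} \<inter> {i, Suc i} = {i, Suc i}" by auto
      then show ?thesis using True ij by (simp add: A_row U_def)
    next
      case False
      then have "m = Suc i" using ij by simp
      moreover then have "hz (a (Suc i) + int j) = 0" using am ij by (simp add: hz_def)
      moreover have "{0..<m} \<inter> {i, Suc i} = {i}" using \<open>m = Suc i\<close> by auto
      ultimately show ?thesis using ij by (simp add: A_row U_def)
    qed
    also have "\<dots> = (\<Sum>b\<in>{a (Suc i) + int j<..a i + int j}. Var n ^ nat (a i + int j -
        b) * trunc n (hz b))"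
    proof -
      have "a (Suc i) + int j + int (nat (a i - a (Suc i))) = a i + int j" using a [of i] ij by simp
      then show ?thesis
        using trunc_hz_telescope [of n "a (Suc i) + int j" "nat (a i - a (Suc i))"]
          by (simp only: x_def)
    qed
    also have "\<dots> = (\<Sum>b\<in>{a (Suc i)<..a i}. Var n ^ nat (a i - b) * trunc n (hz (b + int j)))"
      by (rule sum.reindex_bij_witness [of _ "\<lambda>b. b + int j" "\<lambda>b. b - int j"])
          (auto simp: algebra_simps)
    finally show ?thesis .
  qed
  have "jt_det (Suc n) m a = det A"
    unfolding A_def jt_det_def by (simp add: trunc.hom_det)
  also have "\<dots> = det (U * A)"
    using carr detU by (simp add: det_mult)
  also have "\<dots> = (\<Sum>p | p permutes {0..<m}. signof p * (\<Prod>i=0..<m. (U * A) $$ (i, p i)))"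
    by (rule det_def') (use carr in auto)
  also have "\<dots> = (\<Sum>p | p permutes {0..<m}. signof p * (\<Prod>i=0..<m. 
      \<Sum>b\<in>{a (Suc i)<..a i}. Var n ^ nat (a i - b) * trunc n (hz (b + int (p i)))))"
    by (intro sum.cong arg_cong2 [of _ _ _ _ "(*)"] prod.cong) (auto simp: entry perm)
  also have "\<dots> = (\<Sum>p | p permutes {0..<m}. signof p * 
      (\<Sum>b \<in> PiE {0..<m} (\<lambda>i. {a (Suc i)<..a i}).
        \<Prod>i=0..<m. Var n ^ nat (a i - b i) * trunc n (hz (b i + int (p i)))))"
    by (subst prod_sum_PiE) auto
  also have "\<dots> = (\<Sum>p | p permutes {0..<m}. \<Sum>b \<in> PiE {0..<m} (\<lambda>i. {a (Suc i)<..a i}).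
      (\<Prod>i=0..<m. Var n ^ nat (a i - b i)) * (signof p * (\<Prod>i=0..<m. trunc n (hz (b i + int (p i))))))"
    unfolding sum_distrib_left prod.distrib by (simp add: algebra_simps)
  also have "\<dots> = (\<Sum>b \<in> PiE {0..<m} (\<lambda>i. {a (Suc i)<..a i}).
      (\<Prod>i=0..<m. Var n ^ nat (a i - b i)) * jt_det n m b)"
    unfolding jt_det_leibniz sum_distrib_left by (rule sum.swap)
  finally show ?thesis .
qed

section \<open>Removing the largest entry of a semistandard tableau\<close>

text \<open>
Partitions are continued by zero, which makes the interlacing condition uniform in all rows.
\<close>

definition part :: "nat list \<Rightarrow> nat \<Rightarrow> nat" where
  "part la i = (if i < length la then la ! i else 0)"

definition interlacing :: "nat list \<Rightarrow> nat list set" where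
  "interlacing la = {mu. length mu = length la \<and>
      (\<forall>i < length la. part la (Suc i) \<le> mu ! i \<and> mu ! i \<le> la ! i)}"

definition tableaux :: "nat list \<Rightarrow> nat multiset \<Rightarrow> nat list list set" where
  "tableaux la M = {T. ssyt la T \<and> mset (concat T) = M}"

lemma finite_tableaux: "finite (tableaux la M)"
proof (rule finite_subset)
  let ?R = "{r. set r \<subseteq> set_mset M \<and> length r \<le> size M}"
  show "finite {T. set T \<subseteq> ?R \<and> length T = length la}"
    by (intro finite_lists_length_eq finite_lists_length_le) simp
  show "tableaux la M \<subseteq> {T. set T \<subseteq> ?R \<and> length T = length la}"
  proof
    fix T assume "T \<in> tableaux la M"
    then have T: "length T = length la" "mset (concat T) = M"
      by (auto simp: tableaux_def ssyt_def)
    have "set r \<subseteq> set_mset M \<and> length r \<le> size M" if "r \<in> set T" for r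
    proof
      show "set r \<subseteq> set_mset M" using T that by auto
      have "length r \<le> sum_list (map length T)" using that by (simp add: member_le_sum_list)
      then show "length r \<le> size M" using T by (metis length_concat size_mset)
    qed
    then show "T \<in> {T. set T \<subseteq> ?R \<and> length T = length la}" using T by auto
  qed
qed

lemma finite_interlacing: "finite (interlacing la)"
proof (rule finite_subset)
  show "finite {mu. set mu \<subseteq> {..Max (set la)} \<and> length mu = length la}"
    by (rule finite_lists_length_eq) simp
  show "interlacing la \<subseteq> {mu. set mu \<subseteq> {..Max (set la)} \<and> length mu = length la}"
  proof
    fix mu assume mu: "mu \<in> interlacing la"
    have "mu ! i \<le> Max (set la)" if "i < length la" for i
    proof -
      have "mu ! i \<le> la ! i" using mu that by (auto simp: interlacing_def)
      also have "\<dots> \<le> Max (set la)" using that by simp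
      finally show ?thesis .
    qed
    then show "mu \<in> {mu. set mu \<subseteq> {..Max (set la)} \<and> length mu = length la}"
      using mu by (auto simp: interlacing_def in_set_conv_nth)
  qed
qed

text \<open>
Removing all entries \<open>n\<close> from a tableau with entries at most \<open>n\<close>, and putting them back so that the
shape becomes \<open>la\<close>, are inverse to each other.
\<close>

definition strip :: "nat \<Rightarrow> nat list list \<Rightarrow> nat list list" where
  "strip n T = map (filter (\<lambda>x. x < n)) T"

definition fill :: "nat \<Rightarrow> nat list \<Rightarrow> nat list list \<Rightarrow> nat list list" where
  "fill n la T = map2 (\<lambda>l r. r @ replicate (l - length r) n) la T"

lemma sorted_split_max:
  assumes "sorted r" "\<forall>x\<in>set r. x \<le> n"
  shows "r = filter (\<lambda>x. x < n) r @ replicate (length r - length (filter (\<lambda>x. x < n) r)) (n :: nat)"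
  using assms
proof (induction r)
  case (Cons x r)
  show ?case
  proof (cases "x < n")
    case True
    then show ?thesis using Cons by (simp add: Suc_diff_le)
  next
    case False
    then have "\<forall>y\<in>set (x # r). y = n" using Cons.prems by fastforce
    then have "filter (\<lambda>x. x < n) (x # r) = []" "x # r = replicate (length (x # r)) n"
      by (auto simp: filter_empty_conv intro!: replicate_eqI)
    then show ?thesis by simp
  qed
qed simp

lemma mset_concat_strip: "mset (concat (strip n T)) = filter_mset (\<lambda>x. x < n) (mset (concat T))"
  unfolding strip_def by (induction T) auto

lemma mset_concat_fill:
  assumes "length T = length la" "\<And>i. i < length la \<Longrightarrow> length (T ! i) \<le> la ! i"
  shows "mset (concat (fill n la T)) =
    mset (concat T) + replicate_mset (sum_list la - sum_list (map length T)) n \<and>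
    sum_list (map length T) \<le> sum_list la"
  using assms
proof (induction T la rule: list_induct2)
  case (Cons r T l la)
  have IH: "mset (concat (fill n la T)) =
      mset (concat T) + replicate_mset (sum_list la - sum_list (map length T)) n \<and>
      sum_list (map length T) \<le> sum_list la"
    using Cons.IH Cons.prems by fastforce
  have "length r \<le> l" using Cons.prems [of 0] by simp
  with IH have "replicate_mset (sum_list (l # la) - sum_list (map length (r # T))) n =
    replicate_mset (l - length r) n + replicate_mset (sum_list la - sum_list (map length T)) n"
    by (simp add: multiset_eq_iff)
  then show ?case using IH \<open>length r \<le> l\<close> by (simp add: fill_def)
qed (simp add: fill_def)

text \<open>
In a tableau with entries at most \<open>n\<close>, the entries \<open>n\<close> are at the ends of the rows. As columns
increase strictly, an entry with another one below it is smaller than \<open>n\<close>; so the \<open>i\<close>-th row keeps at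
least as many entries as the next row has, and the remaining shape interlaces with \<open>la\<close>. Conversely,
for an interlacing shape every entry that is put back has nothing below it, so that columns stay strict.
\<close>

lemma bij_betw_strip:
  assumes M: "set_mset M \<subseteq> {..n}" and la: "sorted_wrt (\<ge>) la"
  shows "bij_betw (strip n) (tableaux la M)
    (\<Union>mu \<in> {mu \<in> interlacing la. sum_list la - sum_list mu = count M n}.
       tableaux mu (filter_mset (\<lambda>x. x < n) M))"
    (is "bij_betw _ _ (\<Union>mu \<in> ?I. ?T mu)")
proof (rule bij_betw_byWitness [where f' = "fill n la"])
  let ?f = "filter (\<lambda>x. x < n)"
  have row: "T ! i = ?f (T ! i) @ replicate (la ! i - length (?f (T ! i))) n"
    and row_length: "length T = length la" "length (T ! i) = la ! i"
    if "T \<in> tableaux la M" "i < length la" for T i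
  proof -
    show len: "length T = length la" "length (T ! i) = la ! i"
      using that by (auto simp: tableaux_def ssyt_def)
    have "sorted (T ! i)" using that len by (auto simp: tableaux_def ssyt_def)
    moreover have "set (T ! i) \<subseteq> set_mset M"
      using that len by (auto simp: tableaux_def intro!: bexI [of _ "T ! i"])
    then have "\<forall>x\<in>set (T ! i). x \<le> n" using M by auto
    ultimately show "T ! i = ?f (T ! i) @ replicate (la ! i - length (?f (T ! i))) n"
      using sorted_split_max [of "T ! i" n] len by simp
  qed
  have lenT: "length T = length la" if "T \<in> tableaux la M" for T
    using that by (auto simp: tableaux_def ssyt_def dest: map_eq_imp_length_eq)
  show "\<forall>T\<in>tableaux la M. fill n la (strip n T) = T"
  proof
    fix T assume T: "T \<in> tableaux la M"
    show "fill n la (strip n T) = T"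
    proof (rule nth_equalityI)
      fix i assume "i < length (fill n la (strip n T))"
      then have "i < length la" by (simp add: fill_def)
      then show "fill n la (strip n T) ! i = T ! i"
        using row [OF T] lenT [OF T] by (simp add: fill_def strip_def)
    qed (use lenT [OF T] in \<open>simp add: fill_def strip_def\<close>)
  qed
  have target: "length T = length la" "\<And>i. i < length la \<Longrightarrow> length (T ! i) \<le> la ! i"
    "\<And>i. Suc i < length la \<Longrightarrow> la ! Suc i \<le> length (T ! i)"
    "\<And>i. i < length la \<Longrightarrow> sorted (T ! i)"
    "\<And>i. i < length la \<Longrightarrow> \<forall>x\<in>set (T ! i). x < n"
    "\<And>i j. Suc i < length la \<Longrightarrow> j < length (T ! Suc i) \<Longrightarrow> T ! i ! j < T ! Suc i ! j"
    "mset (concat T) = filter_mset (\<lambda>x. x < n) M"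
    "sum_list la - sum_list (map length T) = count M n"
    if "T \<in> (\<Union>mu \<in> ?I. ?T mu)" for T
  proof -
    from that obtain mu where mu: "mu \<in> interlacing la" "sum_list la - sum_list mu = count M n"
      and T: "ssyt mu T" "mset (concat T) = filter_mset (\<lambda>x. x < n) M"
      by (auto simp: tableaux_def)
    have mu_def: "mu = map length T" using T by (simp add: ssyt_def)
    show len: "length T = length la" using mu by (simp add: interlacing_def mu_def)
    show "\<And>i. i < length la \<Longrightarrow> length (T ! i) \<le> la ! i"
      using mu len by (auto simp: interlacing_def mu_def)
    show "la ! Suc i \<le> length (T ! i)" if "Suc i < length la" for i
    proof -
      have "part la (Suc i) \<le> mu ! i" using mu that by (auto simp: interlacing_def)
      then show ?thesis using that len by (simp add: part_def mu_def)
    qed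
    show "\<And>i. i < length la \<Longrightarrow> sorted (T ! i)" using T len by (auto simp: ssyt_def)
    show "\<forall>x\<in>set (T ! i). x < n" if "i < length la" for i
    proof
      fix x assume "x \<in> set (T ! i)"
      then have "x \<in> set (concat T)" using that len by (auto intro: nth_mem)
      then have "x \<in># filter_mset (\<lambda>x. x < n) M" using T(2) by (metis set_mset_mset)
      then show "x < n" by simp
    qed
    show "\<And>i j. Suc i < length la \<Longrightarrow> j < length (T ! Suc i) \<Longrightarrow> T ! i ! j < T ! Suc i ! j"
      using T len by (auto simp: ssyt_def)
    show "mset (concat T) = filter_mset (\<lambda>x. x < n) M" by fact
    show "sum_list la - sum_list (map length T) = count M n" using mu by (simp add: mu_def)
  qed
  show "\<forall>T\<in>(\<Union>mu \<in> ?I. ?T mu). strip n (fill n la T) = T"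
  proof
    fix T assume T: "T \<in> (\<Union>mu \<in> ?I. ?T mu)"
    note T = target [OF T]
    show "strip n (fill n la T) = T"
    proof (rule nth_equalityI)
      fix i assume "i < length (strip n (fill n la T))"
      then have i: "i < length la" by (simp add: fill_def strip_def)
      have "?f (T ! i) = T ! i" using T(5) i by (simp add: filter_id_conv)
      then show "strip n (fill n la T) ! i = T ! i"
        using i T(1) by (simp add: fill_def strip_def)
    qed (use T(1) in \<open>simp add: fill_def strip_def\<close>)
  qed
  have M_split: "M = filter_mset (\<lambda>x. x < n) M + replicate_mset (count M n) n"
  proof (rule multiset_eqI)
    fix x
    have "count M x = 0" if "x > n" using that M by (auto simp: count_eq_zero_iff)
    then show "count M x = count (filter_mset (\<lambda>x. x < n) M + replicate_mset (count M n) n) x"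
      by (cases x n rule: linorder_cases) auto
  qed
  show "fill n la ` (\<Union>mu \<in> ?I. ?T mu) \<subseteq> tableaux la M"
  proof
    fix T assume "T \<in> fill n la ` (\<Union>mu \<in> ?I. ?T mu)"
    then obtain T' where T'_in: "T' \<in> (\<Union>mu \<in> ?I. ?T mu)" and T: "T = fill n la T'" by blast
    note T' = target [OF T'_in]
    have nth: "T ! i = T' ! i @ replicate (la ! i - length (T' ! i)) n" if "i < length la" for i
      using that T'(1) by (simp add: T fill_def)
    have len: "length T = length la" using T'(1) by (simp add: T fill_def)
    have "ssyt la T" unfolding ssyt_def
    proof (intro conjI allI impI ballI)
      show "map length T = la"
        by (rule nth_equalityI) (use len nth T'(2) in auto)
      show "sorted r" if r: "r \<in> set T" for r
      proof -
        obtain i where i: "i < length la" "r = T ! i" using r len by (auto simp: in_set_conv_nth)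
        show ?thesis using T'(4) [OF i(1)] T'(5) [OF i(1)]
          unfolding i(2) nth [OF i(1)] sorted_append by (auto simp: less_imp_le)
      qed
      fix i j assume "Suc i < length T \<and> j < length (T ! Suc i)"
      then have i: "Suc i < length la" "i < length la" and j: "j < la ! Suc i"
        using len nth [of "Suc i"] T'(2) [of "Suc i"] by auto
      have j': "j < length (T' ! i)" using T'(3) [OF i(1)] j by simp
      then have "T ! i ! j = T' ! i ! j" using nth [OF i(2)] by (simp add: nth_append)
      moreover have "T' ! i ! j < n" using T'(5) [OF i(2)] j' by simp
      moreover have "T ! Suc i ! j = (if j < length (T' ! Suc i) then T' ! Suc i ! j else n)"
        using nth [OF i(1)] j by (auto simp: nth_append)
      ultimately show "T ! i ! j < T ! Suc i ! j" using T'(6) [OF i(1)] by auto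
    qed
    moreover have "mset (concat T) = M"
      using mset_concat_fill [of T' la n] T'(1,2,7,8) M_split unfolding T by metis
    ultimately show "T \<in> tableaux la M" by (simp add: tableaux_def)
  qed
  show "strip n ` tableaux la M \<subseteq> (\<Union>mu \<in> ?I. ?T mu)"
  proof
    fix T' assume "T' \<in> strip n ` tableaux la M"
    then obtain T where T_in: "T \<in> tableaux la M" and T': "T' = strip n T" by blast
    then have T: "ssyt la T" "mset (concat T) = M" by (auto simp: tableaux_def)
    note len = lenT [OF T_in]
    have lenT': "length T' = length la" and nth: "\<And>i. i < length la \<Longrightarrow> T' ! i = ?f (T ! i)"
      using len by (auto simp: T' strip_def)
    have prefix: "T ! i ! j = (if j < length (T' ! i) then T' ! i ! j else n)"
      if "i < length la" "j < la ! i" for i j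
    proof -
      have "T ! i ! j = (T' ! i @ replicate (la ! i - length (T' ! i)) n) ! j"
        using row [OF T_in that(1)] nth [OF that(1)] by simp
      then show ?thesis using that by (auto simp: nth_append)
    qed
    have le: "length (T' ! i) \<le> la ! i" if "i < length la" for i
      using nth [OF that] row_length(2) [OF T_in that] by (metis length_filter_le)
    have col: "T ! i ! j < T ! Suc i ! j" if "Suc i < length la" "j < la ! Suc i" for i j
      using T(1) that len row_length(2) [OF T_in, of "Suc i"] by (auto simp: ssyt_def)
    have ge: "la ! Suc i \<le> length (T' ! i)" if i: "Suc i < length la" for i
    proof (rule ccontr)
      assume "\<not> la ! Suc i \<le> length (T' ! i)"
      then have j: "length (T' ! i) < la ! Suc i" by simp
      have "la ! Suc i \<le> la ! i" using la i sorted_wrt_nth_less [OF la, of i "Suc i"] by simp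
      then have "T ! i ! length (T' ! i) = n" using prefix [of i "length (T' ! i)"] i j by simp
      then have "n < T ! Suc i ! length (T' ! i)" using col [OF i j] by simp
      moreover have "T ! Suc i ! length (T' ! i) \<in> set (concat T)"
        using i j len row_length(2) [OF T_in i] by (auto intro!: bexI [of _ "T ! Suc i"])
      then have "T ! Suc i ! length (T' ! i) \<le> n" using T(2) M
        by (metis atMost_iff set_mset_mset subsetD)
      ultimately show False by simp
    qed
    define mu where "mu = map length T'"
    have cont: "mset (concat T') = filter_mset (\<lambda>x. x < n) M"
      using mset_concat_strip [of n T] T by (simp add: T')
    have "ssyt mu T'" unfolding ssyt_def
    proof (intro conjI allI impI ballI)
      show "map length T' = mu" by (simp add: mu_def)
      show "sorted r" if "r \<in> set T'" for r
        using that T(1) by (auto simp: T' strip_def ssyt_def sorted_wrt_filter)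
      fix i j assume "Suc i < length T' \<and> j < length (T' ! Suc i)"
      then have i: "Suc i < length la" and j: "j < length (T' ! Suc i)" using lenT' by auto
      have "j < la ! Suc i" using j le [OF i] by simp
      moreover then have "j < length (T' ! i)" using ge [OF i] by simp
      moreover then have "j < la ! i" using le [of i] i by simp
      ultimately show "T' ! i ! j < T' ! Suc i ! j"
        using col [OF i, of j] prefix [of i j] prefix [of "Suc i" j] i j by simp
    qed
    moreover have "mu \<in> interlacing la"
      using le ge lenT' by (auto simp: interlacing_def mu_def part_def)
    moreover have "sum_list la - sum_list mu = count M n"
    proof -
      have "sum_list la = size M"
        using T by (metis length_concat size_mset ssyt_def)
      moreover have "sum_list mu = size (filter_mset (\<lambda>x. x < n) M)"
        using cont by (metis length_concat size_mset mu_def)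
      moreover have "size M = size (filter_mset (\<lambda>x. x < n) M) + count M n"
        using arg_cong [OF M_split, of size] by simp
      ultimately show ?thesis by simp
    qed
    ultimately show "T' \<in> (\<Union>mu \<in> ?I. ?T mu)" using cont by (auto simp: tableaux_def)
  qed
qed

section \<open>The Jacobi-Trudi identity\<close>

definition schur_series :: "nat list \<Rightarrow> mseries" where
  "schur_series la = Mseries (schur la)"

lemma coeff_schur_series [simp]: "coeff (schur_series la) M = of_nat (card (tableaux la M))"
  by (simp add: schur_series_def schur_def tableaux_def)

definition shifted :: "nat list \<Rightarrow> nat \<Rightarrow> int" where
  "shifted la i = int (part la i) - int i"

lemma sorted_interlacing:
  assumes "mu \<in> interlacing la"
  shows "sorted_wrt (\<ge>) mu"
proof -
  have "mu ! Suc i \<le> mu ! i" if "Suc i < length mu" for i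
  proof -
    have "mu ! Suc i \<le> la ! Suc i" "part la (Suc i) \<le> mu ! i"
      using assms that by (auto simp: interlacing_def)
    then show ?thesis using assms that by (auto simp: interlacing_def part_def)
  qed
  then show ?thesis by (subst sorted_wrt_iff_nth_Suc_transp) (auto intro: transpI)
qed

text \<open>
Both sides have coefficients that count tableaux; the power of \<open>x\<^sub>n\<close> records the number of removed
entries, which the monomial determines.
\<close>

lemma trunc_schur_Suc:
  assumes "sorted_wrt (\<ge>) la"
  shows "trunc (Suc n) (schur_series la) =
    (\<Sum>mu\<in>interlacing la. Var n ^ (sum_list la - sum_list mu) * trunc n (schur_series mu))"
proof (rule mseries_eqI)
  fix M
  let ?d = "\<lambda>mu. sum_list la - sum_list mu"
  let ?N = "filter_mset (\<lambda>x. x < n) M"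
  have "coeff (trunc (Suc n) (schur_series la)) M =
      (\<Sum>mu\<in>interlacing la. coeff (Var n ^ ?d mu * trunc n (schur_series mu)) M)"
  proof (cases "set_mset M \<subseteq> {..n}")
    case True
    have set: "set_mset (M - replicate_mset d n) \<subseteq> {..<n} \<longleftrightarrow> d = count M n" if "d \<le> count M n" for d
    proof
      assume "set_mset (M - replicate_mset d n) \<subseteq> {..<n}"
      then have "n \<notin># M - replicate_mset d n" by auto
      then show "d = count M n" using that by (simp add: not_in_iff)
    next
      assume d: "d = count M n"
      show "set_mset (M - replicate_mset d n) \<subseteq> {..<n}"
      proof
        fix x assume x: "x \<in># M - replicate_mset d n"
        then have "x \<le> n" using True by (auto dest: in_diffD)
        moreover have "x \<noteq> n" using x d by (auto simp: in_diff_count)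
        ultimately show "x \<in> {..<n}" by simp
      qed
    qed
    have diff: "M - replicate_mset (count M n) n = ?N"
    proof (rule multiset_eqI)
      fix x
      have "count M x = 0" if "x > n" using that True by (auto simp: count_eq_zero_iff)
      then show "count (M - replicate_mset (count M n) n) x = count ?N x"
        by (cases x n rule: linorder_cases) auto
    qed
    have summand: "coeff (Var n ^ ?d mu * trunc n (schur_series mu)) M =
        (if ?d mu = count M n then of_nat (card (tableaux mu ?N)) else 0)" for mu
      using set [of "?d mu"] diff by (auto simp: coeff_Var_power_mult)
    have "coeff (trunc (Suc n) (schur_series la)) M = of_nat (card (tableaux la M))"
      using True by (auto simp: less_Suc_eq_le)
    also have "card (tableaux la M) =
        card (\<Union>mu \<in> {mu \<in> interlacing la. ?d mu = count M n}. tableaux mu ?N)"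
      by (rule bij_betw_same_card [OF bij_betw_strip [OF True assms]])
    also have "\<dots> = (\<Sum>mu\<in>{mu \<in> interlacing la. ?d mu = count M n}. card (tableaux mu ?N))"
      by (rule card_UN_disjoint)
          (auto simp: finite_interlacing finite_tableaux, auto simp: tableaux_def ssyt_def)
    also have "\<dots> = (\<Sum>mu\<in>interlacing la. if ?d mu = count M n then card (tableaux mu ?N) else 0)"
      by (rule sum.inter_filter) (rule finite_interlacing)
    finally show ?thesis by (simp add: summand of_nat_sum if_distrib [of of_nat] cong: if_cong)
  next
    case False
    then obtain x where x: "x \<in># M" "x > n" by (meson atMost_iff not_le subsetI)
    have "x \<in># M - replicate_mset d n" for d using x by (simp add: in_diff_count)
    then have "\<not> set_mset (M - replicate_mset d n) \<subseteq> {..<n}" for d using x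
      by (metis lessThan_iff order.asym subsetD)
    moreover have "\<not> set_mset M \<subseteq> {..<Suc n}" using x by force
    ultimately show ?thesis by (simp add: coeff_Var_power_mult cong: if_cong)
  qed
  then show "coeff (trunc (Suc n) (schur_series la)) M =
    coeff (\<Sum>mu\<in>interlacing la. Var n ^ ?d mu * trunc n (schur_series mu)) M" by simp
qed

lemma jt_det_cong: "(\<And>i. i < m \<Longrightarrow> a i = b i) \<Longrightarrow> jt_det n m a = jt_det n m b"
  unfolding jt_det_leibniz by (intro sum.cong arg_cong2 [of _ _ _ _ "(*)"] prod.cong) auto

lemma trunc_0: "trunc 0 f = const (coeff f {#})"
  by (rule mseries_eqI) (simp add: const_eq_scale coeff_1)

text \<open>
Both sides satisfy the same recursion in the number of variables, as the interlacing partitions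
correspond to the points \<open>b\<close> of the product of intervals in \<open>jt_det_Suc\<close>. Without variables, the matrix
is the identity for the zero partition and otherwise has a zero first row.
\<close>

lemma jacobi_trudi_trunc:
  assumes "sorted_wrt (\<ge>) la"
  shows "trunc n (schur_series la) = jt_det n (length la) (shifted la)"
  using assms
proof (induction n arbitrary: la)
  case 0
  let ?m = "length la"
  show ?case
  proof (cases "set la \<subseteq> {0}")
    case True
    then have la: "la = replicate ?m 0" by (auto intro: replicate_eqI)
    then have row: "part la i = 0" for i by (metis nth_replicate part_def)
    have "map_mat (trunc 0) (jt_mat ?m (shifted la)) = 1\<^sub>m ?m"
      by (rule eq_matI) (auto simp: jt_mat_def trunc_0 shifted_def row const_eq_scale)
    then have 1: "jt_det 0 ?m (shifted la) = 1"
      unfolding jt_det_def by (metis det_one trunc.hom_det)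
    have "tableaux la {#} = {replicate ?m []}"
    proof (intro equalityI subsetI)
      fix T assume "T \<in> tableaux la {#}"
      then have "length T = ?m" "\<forall>r\<in>set T. r = []" by (auto simp: tableaux_def ssyt_def)
      then show "T \<in> {replicate ?m []}" by (auto intro: replicate_eqI)
    next
      fix T :: "nat list list" assume "T \<in> {replicate ?m []}"
      then have T: "T = replicate ?m []" by simp
      have "map length T = la" unfolding T by (subst (2) la) simp
      then show "T \<in> tableaux la {#}" by (auto simp: tableaux_def ssyt_def T)
    qed
    then show ?thesis using 1 by (simp add: trunc_0 const_eq_scale)
  next
    case False
    then obtain j where j: "j < ?m" "la ! j > 0"
      by (metis gr0I in_set_conv_nth singletonI subsetI)
    then have m: "0 < ?m" by auto
    have "la ! j \<le> la ! 0" using sorted_wrt_nth_less [OF "0.prems", of 0 j] j by (cases "j = 0") auto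
    then have pos: "la ! 0 > 0" using j by simp
    have "(\<Prod>i=0..<?m. trunc 0 (hz (shifted la i + int (p i)))) = 0" for p
      by (rule prod_zero) (use m pos in \<open>auto simp: trunc_0 const_eq_scale shifted_def part_def
          intro!: bexI [of _ 0]\<close>)
    then have 1: "jt_det 0 ?m (shifted la) = 0" unfolding jt_det_leibniz by simp
    have "tableaux la {#} = {}"
    proof (rule ccontr)
      assume "tableaux la {#} \<noteq> {}"
      then obtain T where "T \<in> tableaux la {#}" by blast
      then have T: "map length T = la" "\<forall>r\<in>set T. r = []"
        by (auto simp: tableaux_def ssyt_def)
      then have "la ! 0 = 0" using m by (metis length_map list.size(3) nth_map nth_mem)
      then show False using pos by simp
    qed
    then show ?thesis using 1 by (simp add: trunc_0 const_eq_scale)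
  qed
next
  case (Suc n)
  let ?m = "length la"
  let ?a = "shifted la"
  let ?B = "PiE {0..<?m} (\<lambda>i. {?a (Suc i)<..?a i})"
  let ?mu = "\<lambda>b. map (\<lambda>i. nat (b i + int i)) [0..<?m]"
  let ?b = "\<lambda>mu. restrict (shifted mu) {0..<?m}"
  have row_le: "part la (Suc i) \<le> part la i" for i
    using sorted_wrt_nth_less [OF Suc.prems, of i "Suc i"] by (auto simp: part_def)
  have "jt_det (Suc n) ?m ?a = (\<Sum>b\<in>?B. (\<Prod>i=0..<?m. Var n ^ nat (?a i - b i)) * jt_det n ?m b)"
  proof (rule jt_det_Suc)
    show "?a (Suc i) \<le> ?a i" for i using row_le [of i] by (simp add: shifted_def)
    show "?a ?m = - int ?m" by (simp add: shifted_def part_def)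
  qed
  also have "\<dots> = (\<Sum>mu\<in>interlacing la. Var n ^ (sum_list la -
      sum_list mu) * trunc n (schur_series mu))"
  proof (rule sum.reindex_bij_witness [where i = ?b and j = ?mu])
    fix b assume b: "b \<in> ?B"
    then have bi: "?a (Suc i) < b i" "b i \<le> ?a i" if "i < ?m" for i
      using that by (auto simp: PiE_iff)
    have row_mu: "int (part (?mu b) i) = b i + int i" if "i < ?m" for i
      using bi [OF that] that by (simp add: part_def shifted_def)
    show mu: "?mu b \<in> interlacing la"
    proof -
      have "part la (Suc i) \<le> nat (b i + int i) \<and> nat (b i + int i) \<le> la ! i" if "i < ?m" for i
        using bi [OF that] that by (simp add: shifted_def part_def [of la i]) linarith
      then show ?thesis by (simp add: interlacing_def)
    qed
    show "?b (?mu b) = b"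
    proof (rule ext)
      fix i show "?b (?mu b) i = b i"
        using b row_mu by (cases "i < ?m") (auto simp: shifted_def PiE_iff extensional_def)
    qed
    have "sum_list la - sum_list (?mu b) = (\<Sum>i=0..<?m. nat (?a i - b i))"
    proof -
      have "sum_list (?mu b) = (\<Sum>i=0..<?m. part (?mu b) i)"
        by (subst sum_list_sum_nth) (auto simp: part_def)
      moreover have "sum_list la = (\<Sum>i=0..<?m. part la i)"
        by (subst sum_list_sum_nth) (auto simp: part_def)
      moreover have "part la i = part (?mu b) i + nat (?a i - b i)" if "i < ?m" for i
        using row_mu [OF that] bi [OF that] by (simp add: shifted_def)
      ultimately show ?thesis by (simp add: sum.distrib)
    qed
    moreover have "trunc n (schur_series (?mu b)) = jt_det n ?m b"
    proof -
      have "trunc n (schur_series (?mu b)) = jt_det n ?m (shifted (?mu b))"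
        using Suc.IH [OF sorted_interlacing [OF mu]] by simp
      also have "\<dots> = jt_det n ?m b"
        by (rule jt_det_cong) (simp add: shifted_def row_mu)
      finally show ?thesis .
    qed
    ultimately show "Var n ^ (sum_list la - sum_list (?mu b)) * trunc n (schur_series (?mu b)) =
        (\<Prod>i=0..<?m. Var n ^ nat (?a i - b i)) * jt_det n ?m b"
      by (simp add: power_sum)
  next
    fix mu assume mu: "mu \<in> interlacing la"
    then have len: "length mu = ?m" by (simp add: interlacing_def)
    show "?mu (?b mu) = mu"
      by (rule nth_equalityI) (auto simp: len shifted_def part_def)
    show "?b mu \<in> ?B"
    proof -
      have "?a (Suc i) < shifted mu i \<and> shifted mu i \<le> ?a i" if "i < ?m" for i
      proof -
        have "part la (Suc i) \<le> mu ! i" "mu ! i \<le> la ! i" using mu that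
          by (auto simp: interlacing_def)
        then show ?thesis using that
          by (simp add: shifted_def part_def [of la i] part_def [of mu i] len)
      qed
      then show ?thesis by (auto simp: PiE_iff)
    qed
  qed
  also have "\<dots> = trunc (Suc n) (schur_series la)"
    using trunc_schur_Suc [OF Suc.prems] by simp
  finally show ?case by simp
qed

text \<open>
Each coefficient only involves finitely many variables.
\<close>

lemma jacobi_trudi:
  assumes "sorted_wrt (\<ge>) la"
  shows "schur_series la = det (jt_mat (length la) (shifted la))"
proof (rule mseries_eqI)
  fix M :: "nat multiset"
  obtain n where "\<forall>x\<in>set_mset M. x < n"
    using finite_nat_set_iff_bounded [of "set_mset M"] by auto
  then have n: "set_mset M \<subseteq> {..<n}" by auto
  have "coeff (trunc n (schur_series la)) M =
      coeff (trunc n (det (jt_mat (length la) (shifted la)))) M"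
    using jacobi_trudi_trunc [OF assms, of n] by (simp only: jt_det_def)
  then show "coeff (schur_series la) M = coeff (det (jt_mat (length la) (shifted la))) M"
    using n by simp
qed

section \<open>Leading terms of the rectangular Schur functions\<close>

text \<open>
A strictly concave function with \<open>hw k 0 = 0\<close>, as \<open>h\<^sub>0 = 1\<close> has to have weight zero. On the relevant
range \<open>i \<le> k\<close> the truncated subtraction is exact.
\<close>

definition hw :: "nat \<Rightarrow> nat \<Rightarrow> nat" where
  "hw k i = i * (2 * k - i)"

lemma weight_nonzero:
  assumes "w 0 = 0"
  shows "weight w (filter_mset (\<lambda>x. x \<noteq> 0) \<alpha>) = weight w \<alpha>"
  by (induction \<alpha>) (auto simp: assms)

lemma monomial_hsym_nonzero: "monomial hsym (filter_mset (\<lambda>x. x \<noteq> 0) \<alpha>) = monomial hsym \<alpha>"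
  by (induction \<alpha>) auto

lemma monomial_image_mset_set: "monomial b (image_mset f (mset_set A)) = (\<Prod>i\<in>A. b (f i))"
  by (simp add: monomial_def image_mset.compositionality prod_unfold_prod_mset comp_def)

lemma weight_image_mset_set: "weight w (image_mset f (mset_set A)) = (\<Sum>i\<in>A. w (f i))"
  by (simp add: weight_def image_mset.compositionality sum_unfold_sum_mset comp_def)

text \<open>
With \<open>e\<^sub>i = p(i) - i\<close> the sum on the left differs from \<open>m\<close> times the weight of \<open>l\<close> by a multiple of the
sum of the \<open>e\<^sub>i\<close>, which vanishes, and by minus the sum of their squares.
\<close>

lemma sum_hw_permutation:
  assumes p: "p permutes {0..<m}" "p \<noteq> id" and l: "l \<le> k" "m + l = k + 1"
    and pos: "\<And>i. i < m \<Longrightarrow> i \<le> l + p i"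
  shows "(\<Sum>i=0..<m. hw k (l + p i - i)) < m * hw k l"
proof -
  have le: "p i < m" if "i < m" for i using permutes_in_image [OF p(1), of i] that by simp
  define e where "e i = int (p i) - int i" for i
  have "int (hw k (l + p i - i)) = int (hw k l) + e i * (2 * (int k - int l)) - (e i)\<^sup>2" if "i < m"
    for i
  proof -
    have "l + p i - i \<le> 2 * k" using le [OF that] l by simp
    moreover have "int (l + p i - i) = int l + e i" using pos [OF that] by (simp add: e_def)
    ultimately have "int (hw k (l + p i - i)) = (int l + e i) * (2 * int k - (int l + e i))"
      unfolding hw_def by (simp add: of_nat_diff)
    moreover have "int (hw k l) = int l * (2 * int k - int l)" using l
      by (simp add: hw_def of_nat_diff)
    ultimately show ?thesis by (simp add: power2_eq_square algebra_simps)
  qed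
  then have "int (\<Sum>i=0..<m. hw k (l + p i - i)) =
      (\<Sum>i=0..<m. int (hw k l) + e i * (2 * (int k - int l)) - (e i)\<^sup>2)"
    unfolding of_nat_sum by (intro sum.cong) auto
  also have "\<dots> = int (m * hw k l) + (\<Sum>i=0..<m. e i) * (2 * (int k - int l)) - (\<Sum>i=0..<m. (e i)\<^sup>2)"
    by (simp add: sum.distrib sum_subtractf sum_distrib_right)
  also have "(\<Sum>i=0..<m. e i) = 0"
    unfolding e_def sum_subtractf using sum.permute [OF p(1), of int] by (simp add: comp_def)
  finally have eq: "int (\<Sum>i=0..<m. hw k (l + p i - i)) = int (m * hw k l) - (\<Sum>i=0..<m. (e i)\<^sup>2)"
    by simp
  obtain i where i: "p i \<noteq> i" using p(2) by (auto simp: fun_eq_iff)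
  then have "i < m" using permutes_not_in [OF p(1)] by force
  then have "(\<Sum>i=0..<m. (e i)\<^sup>2) > 0"
    using i by (intro sum_pos2 [of _ i]) (auto simp: e_def)
  then show ?thesis using eq by linarith
qed

text \<open>
The leading term is the diagonal of the Jacobi-Trudi matrix. The bound \<open>l - i + p(i) \<le> k\<close>, which is
specific to rectangles of this size, keeps all terms of the determinant in \<open>\<rat>[h\<^sub>1, \<dots>, h\<^sub>k]\<close>.
\<close>

lemma has_lead_schur_rectangle:
  assumes l: "1 \<le> l" "l \<le> k"
  shows "has_lead hsym (hw k) {1..k} (schur_series (k_rectangle k l)) (replicate_mset (k + 1 - l) l)"
proof -
  define m where "m = k + 1 - l"
  have ml: "m + l = k + 1" using l by (simp add: m_def)
  let ?L = "lower hsym (hw k) {1..k} (m * hw k l)"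
  let ?t = "\<lambda>p. signof p * (\<Prod>i=0..<m. hz (int l - int i + int (p i)))"
  have fin: "finite {p. p permutes {0..<m}}" by (rule finite_permutations) simp
  have "schur_series (k_rectangle k l) = det (jt_mat m (shifted (replicate m l)))"
    unfolding k_rectangle_def m_def [symmetric]
    using jacobi_trudi [of "replicate m l"] by (simp add: sorted_wrt_iff_nth_less)
  also have "\<dots> = (\<Sum>p | p permutes {0..<m}. signof p *
      (\<Prod>i=0..<m. jt_mat m (shifted (replicate m l)) $$ (i, p i)))"
    by (rule det_def') (simp add: jt_mat_def)
  also have "\<dots> = sum ?t {p. p permutes {0..<m}}"
  proof (intro sum.cong arg_cong2 [of _ _ _ _ "(*)"] prod.cong refl)
    fix p i assume p: "p \<in> {p. p permutes {0..<m}}" and i: "i \<in> {0..<m}"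
    then have "p i < m" using permutes_in_image [of p "{0..<m}" i] by simp
    then show "jt_mat m (shifted (replicate m l)) $$ (i, p i) = hz (int l - int i + int (p i))"
      using i by (simp add: jt_mat_def shifted_def part_def)
  qed
  also have "\<dots> = ?t id + sum ?t ({p. p permutes {0..<m}} - {id})"
    by (rule sum.remove) (auto simp: fin permutes_id)
  also have "?t id = monomial hsym (replicate_mset m l)"
    by (simp add: sign_id hz_def monomial_def)
  finally have eq: "schur_series (k_rectangle k l) - scale 1 (monomial hsym (replicate_mset m l)) =
      sum ?t ({p. p permutes {0..<m}} - {id})"
    by (simp only: mseries.scale_one add_diff_cancel_left')
  have "?t p \<in> ?L" if "p \<in> {p. p permutes {0..<m}} - {id}" for p
  proof (cases "\<forall>i<m. i \<le> l + p i")
    case True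
    have p: "p permutes {0..<m}" "p \<noteq> id" using that by auto
    have le: "p i < m" if "i < m" for i using permutes_in_image [OF p(1), of i] that by simp
    \<comment> \<open>indices zero have to be dropped, since only \<open>h\<^sub>1, \<dots>, h\<^sub>k\<close> are generators\<close>
    define \<alpha>0 where "\<alpha>0 = image_mset (\<lambda>i. l + p i - i) (mset_set {0..<m})"
    define \<alpha> where "\<alpha> = filter_mset (\<lambda>x. x \<noteq> 0) \<alpha>0"
    have "(\<Prod>i=0..<m. hz (int l - int i + int (p i))) = monomial hsym \<alpha>"
      unfolding \<alpha>_def monomial_hsym_nonzero \<alpha>0_def monomial_image_mset_set
    proof (rule prod.cong)
      fix i assume "i \<in> {0..<m}"
      then have "int l - int i + int (p i) = int (l + p i - i)" using True by auto
      then show "hz (int l - int i + int (p i)) = hsym (l + p i - i)"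
        unfolding hz_def by (simp only: nat_int) simp
    qed simp
    moreover have "monomial hsym \<alpha> \<in> ?L"
      unfolding lower_def
    proof (intro mseries.span_base imageI CollectI conjI)
      show "\<alpha> \<in> msets {1..k}"
        using le ml by (fastforce simp: \<alpha>_def \<alpha>0_def msets_def)
      have "weight (hw k) \<alpha> = (\<Sum>i=0..<m. hw k (l + p i - i))"
        unfolding \<alpha>_def \<alpha>0_def
        by (subst weight_nonzero) (simp_all add: hw_def weight_image_mset_set)
      then show "weight (hw k) \<alpha> < m * hw k l"
        using sum_hw_permutation [OF p l(2) ml] True by simp
    qed
    moreover have "signof p * f = scale (signof p) f" for f :: mseries
      by (cases p rule: sign_cases) auto
    ultimately show ?thesis unfolding lower_def by (metis mseries.span_scale)
  next
    case False
    then obtain i where "i < m" "l + p i < i" by (auto simp: not_le)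
    then have "(\<Prod>i=0..<m. hz (int l - int i + int (p i))) = 0"
      by (intro prod_zero) (auto simp: hz_def intro!: bexI [of _ i])
    then show ?thesis by (simp add: lower_def mseries.span_zero)
  qed
  then have "sum ?t ({p. p permutes {0..<m}} - {id}) \<in> ?L"
    unfolding lower_def by (rule mseries.span_sum)
  then show ?thesis
    unfolding has_lead_def m_def [symmetric] using eq l
    by (auto simp: msets_def weight_def intro!: exI [of _ 1] split: if_splits)
qed

section \<open>A basis adapted to the ideal of the rectangular Schur functions\<close>

abbreviation rect_schur :: "nat \<Rightarrow> nat \<Rightarrow> mseries" where
  "rect_schur k l \<equiv> schur_series (k_rectangle k l)"

definition quo :: "nat \<Rightarrow> nat multiset \<Rightarrow> nat multiset" where
  "quo k \<gamma> = (\<Sum>l\<in>{1..k}. replicate_mset (count \<gamma> l div (k + 1 - l)) l)"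

definition rem :: "nat \<Rightarrow> nat multiset \<Rightarrow> nat multiset" where
  "rem k \<gamma> = (\<Sum>l\<in>{1..k}. replicate_mset (count \<gamma> l mod (k + 1 - l)) l)"

definition adapted :: "nat \<Rightarrow> nat multiset \<Rightarrow> mseries" where
  "adapted k \<gamma> = monomial (rect_schur k) (quo k \<gamma>) * monomial hsym (rem k \<gamma>)"

definition irreducibles :: "nat \<Rightarrow> nat multiset set" where
  "irreducibles k = {\<gamma> \<in> msets {1..k}. \<forall>l\<in>{1..k}. count \<gamma> l \<le> k - l}"

definition V_span :: "nat \<Rightarrow> mseries set" where
  "V_span k = mseries.span (monomial hsym ` msets {1..k})"

definition I_span :: "nat \<Rightarrow> mseries set" where
  "I_span k = mseries.span (adapted k ` (msets {1..k} - irreducibles k))"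

lemma count_quo: "count (quo k \<gamma>) l = (if l \<in> {1..k} then count \<gamma> l div (k + 1 - l) else 0)"
  by (simp add: quo_def count_sum sum.delta)

lemma count_rem: "count (rem k \<gamma>) l = (if l \<in> {1..k} then count \<gamma> l mod (k + 1 - l) else 0)"
  by (simp add: rem_def count_sum sum.delta)

lemma quo_in_msets: "quo k \<gamma> \<in> msets {1..k}" and rem_in_msets: "rem k \<gamma> \<in> msets {1..k}"
  by (auto simp: msets_def count_quo count_rem simp flip: count_greater_zero_iff split: if_splits)

lemma count_not_in_msets: "\<gamma> \<in> msets X \<Longrightarrow> l \<notin> X \<Longrightarrow> count \<gamma> l = 0"
  by (auto simp: msets_def count_eq_zero_iff)

lemma quo_rem:
  assumes "\<gamma> \<in> msets {1..k}"
  shows "(\<Sum>l\<in>#quo k \<gamma>. replicate_mset (k + 1 - l) l) + rem k \<gamma> = \<gamma>"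
proof (rule multiset_eqI)
  fix l
  have "count (\<Sum>j\<in>#\<beta>. replicate_mset (k + 1 - j) j) l = count \<beta> l * (k + 1 - l)" for \<beta>
    by (induction \<beta>) auto
  then show "count ((\<Sum>l\<in>#quo k \<gamma>. replicate_mset (k + 1 - l) l) + rem k \<gamma>) l = count \<gamma> l"
    using count_not_in_msets [OF assms, of l] div_mult_mod_eq [of "count \<gamma> l" "k + 1 - l"]
    by (cases "l \<in> {1..k}") (simp_all only: count_union count_quo count_rem if_True if_False
        mult_zero_left add_0 not_False_eq_True)
qed

lemma has_lead_adapted:
  assumes "\<gamma> \<in> msets {1..k}"
  shows "has_lead hsym (hw k) {1..k} (adapted k \<gamma>) \<gamma>"
proof -
  have "has_lead hsym (hw k) {1..k} (monomial (rect_schur k) (quo k \<gamma>))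
      (\<Sum>l\<in>#quo k \<gamma>. replicate_mset (k + 1 - l) l)"
    using quo_in_msets [of k \<gamma>]
      by (intro has_lead_prod has_lead_schur_rectangle) (auto simp: msets_def)
  from has_lead_mult [OF this has_lead_monomial [OF rem_in_msets [of k \<gamma>]]] show ?thesis
    unfolding adapted_def quo_rem [OF assms] .
qed

lemma indep_family_adapted: "indep_family (adapted k) (msets {1..k})"
proof (rule indep_family_has_lead [OF _ has_lead_adapted])
  have "msets {1..k} \<subseteq> msets {1..}" by (auto simp: msets_def)
  then show "indep_family (monomial hsym) (msets {1..k})"
    using indep_family_hsym unfolding indep_family_def by (meson subset_trans)
qed

lemma V_span_eq: "V_span k = mseries.span (adapted k ` msets {1..k})"
  unfolding V_span_def by (rule span_has_lead [OF has_lead_adapted, symmetric])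

text \<open>
This is where irreducibility enters: at most \<open>k - l\<close> parts equal to \<open>l\<close> means that the
division of the multiplicity of \<open>l\<close> by \<open>k + 1 - l\<close> has quotient zero.
\<close>

lemma quo_eq_empty:
  assumes "\<gamma> \<in> msets {1..k}"
  shows "quo k \<gamma> = {#} \<longleftrightarrow> \<gamma> \<in> irreducibles k"
proof
  assume *: "quo k \<gamma> = {#}"
  have "count \<gamma> l \<le> k - l" if "l \<in> {1..k}" for l
  proof -
    have "count \<gamma> l div (k + 1 - l) = 0" using * count_quo [of k \<gamma> l] that by simp
    then show ?thesis using that by (auto simp: div_eq_0_iff)
  qed
  then show "\<gamma> \<in> irreducibles k" using assms by (auto simp: irreducibles_def)
next
  assume "\<gamma> \<in> irreducibles k"
  then have "count (quo k \<gamma>) l = 0" for l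
    unfolding count_quo by (force simp: irreducibles_def)
  then show "quo k \<gamma> = {#}" by (simp add: multiset_eq_iff)
qed

lemma adapted_irreducible:
  assumes "\<gamma> \<in> irreducibles k"
  shows "adapted k \<gamma> = monomial hsym \<gamma>"
proof -
  have \<gamma>: "\<gamma> \<in> msets {1..k}" using assms by (simp add: irreducibles_def)
  then have "quo k \<gamma> = {#}" using assms quo_eq_empty by blast
  moreover then have "rem k \<gamma> = \<gamma>" using quo_rem [OF \<gamma>] by simp
  ultimately show ?thesis by (simp add: adapted_def)
qed

lemma subspace_V_span: "mseries.subspace (V_span k)"
  and subspace_I_span: "mseries.subspace (I_span k)"
  by (simp_all add: V_span_def I_span_def mseries.subspace_span)

lemma monomial_hsym_in_V_span: "\<alpha> \<in> msets {1..k} \<Longrightarrow> monomial hsym \<alpha> \<in> V_span k"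
  unfolding V_span_def by (intro mseries.span_base imageI)

lemma one_in_V_span: "1 \<in> V_span k"
  using monomial_hsym_in_V_span [of "{#}" k] by simp

lemma hsym_in_V_span: "l \<in> {1..k} \<Longrightarrow> hsym l \<in> V_span k"
  using monomial_hsym_in_V_span [of "{#l#}" k] by simp

lemma mult_in_V_span: "f \<in> V_span k \<Longrightarrow> g \<in> V_span k \<Longrightarrow> f * g \<in> V_span k"
  unfolding V_span_def
  by (elim span_mult) (auto simp flip: monomial_union intro!: mseries.span_base imageI)

lemma rect_schur_in_V_span:
  assumes "l \<in> {1..k}"
  shows "rect_schur k l \<in> V_span k"
proof -
  have "has_lead hsym (hw k) {1..k} (rect_schur k l) (replicate_mset (k + 1 - l) l)"
    using assms by (intro has_lead_schur_rectangle) auto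
  then have "rect_schur k l \<in> lower hsym (hw k) {1..k} (Suc (weight (hw k) (replicate_mset (k + 1 -
      l) l)))"
    by (rule has_lead_imp_lower) simp
  also have "\<dots> \<subseteq> V_span k"
    unfolding lower_def V_span_def by (rule mseries.span_mono) auto
  finally show ?thesis .
qed

lemma monomial_in_V_span: "(\<And>l. l \<in># \<beta> \<Longrightarrow> b l \<in> V_span k) \<Longrightarrow> monomial b \<beta> \<in> V_span k"
  by (induction \<beta>) (auto simp: one_in_V_span intro: mult_in_V_span)

text \<open>
Adding \<open>k + 1 - l\<close> to a multiplicity raises the quotient by one and leaves the remainder unchanged.
\<close>

lemma rect_schur_mult_adapted:
  assumes l: "l \<in> {1..k}"
  shows "rect_schur k l * adapted k \<gamma> = adapted k (\<gamma> + replicate_mset (k + 1 - l) l)"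
proof -
  define m where "m = k + 1 - l"
  have "m > 0" using l by (simp add: m_def)
  have "quo k (\<gamma> + replicate_mset (k + 1 - l) l) = add_mset l (quo k \<gamma>)"
    by (rule multiset_eqI) (use l \<open>m > 0\<close> in \<open>auto simp: count_quo simp del: One_nat_def simp flip:
        m_def\<close>)
  moreover have "rem k (\<gamma> + replicate_mset (k + 1 - l) l) = rem k \<gamma>"
    by (rule multiset_eqI) (use l \<open>m > 0\<close> in \<open>auto simp: count_rem simp del: One_nat_def simp flip:
        m_def\<close>)
  ultimately show ?thesis by (simp add: adapted_def mult.assoc)
qed

lemma rect_schur_mult_in_I_span:
  assumes l: "l \<in> {1..k}" and f: "f \<in> V_span k"
  shows "rect_schur k l * f \<in> I_span k"
proof -
  have "\<gamma> + replicate_mset (k + 1 - l) l \<in> msets {1..k} - irreducibles k" if "\<gamma> \<in> msets {1..k}" for \<gamma>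
  proof -
    have "\<not> count (\<gamma> + replicate_mset (k + 1 - l) l) l \<le> k - l" using l by auto
    then show ?thesis using that l by (auto simp: irreducibles_def msets_def split: if_splits)
  qed
  then have "rect_schur k l * adapted k \<gamma> \<in> I_span k" if "\<gamma> \<in> msets {1..k}" for \<gamma>
    unfolding I_span_def rect_schur_mult_adapted [OF l] using that by (intro mseries.span_base imageI)
  then show ?thesis
    using span_mult [OF mseries.span_base [of "rect_schur k l" "{rect_schur k l}"] f
        [unfolded V_span_eq],
        of "adapted k ` (msets {1..k} - irreducibles k)"]
    unfolding I_span_def by blast
qed

lemma adapted_factor:
  assumes "\<gamma> \<in> msets {1..k} - irreducibles k"
  obtains l u where "l \<in> {1..k}" "u \<in> V_span k" "adapted k \<gamma> = rect_schur k l * u"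
proof -
  have "quo k \<gamma> \<noteq> {#}" using assms quo_eq_empty by auto
  then obtain l q where q: "quo k \<gamma> = add_mset l q" by (metis multiset_cases)
  then have l: "l \<in> {1..k}" and qs: "q \<in> msets {1..k}" using quo_in_msets [of k \<gamma>] by auto
  have "monomial (rect_schur k) q * monomial hsym (rem k \<gamma>) \<in> V_span k"
    using qs by (intro mult_in_V_span monomial_in_V_span [of q] monomial_hsym_in_V_span rem_in_msets
        rect_schur_in_V_span) (auto simp: msets_def)
  moreover have "adapted k \<gamma> = rect_schur k l * (monomial (rect_schur k) q * monomial hsym (rem k \<gamma>))"
    by (simp add: adapted_def q mult.assoc)
  ultimately show thesis using that l by blast
qed

lemma I_span_subset_V_span: "I_span k \<subseteq> V_span k"
  unfolding I_span_def V_span_eq by (rule mseries.span_mono) auto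

text \<open>
Each generator of \<open>I_span k\<close> has a factor \<open>rect_schur k l\<close>, and a multiple of that factor in \<open>V_span k\<close>
can be expanded in the adapted family, where multiplication by \<open>rect_schur k l\<close> only shifts indices.
\<close>

lemma I_span_ideal:
  assumes "f \<in> I_span k" "g \<in> V_span k"
  shows "f * g \<in> I_span k"
proof -
  have gen: "adapted k \<gamma> * g \<in> I_span k" if \<gamma>: "\<gamma> \<in> msets {1..k} - irreducibles k" for \<gamma>
  proof -
    obtain l u where l: "l \<in> {1..k}" and u: "u \<in> V_span k" and x: "adapted k \<gamma> = rect_schur k l * u"
      using adapted_factor [OF \<gamma>] .
    show ?thesis
      unfolding x mult.assoc by (rule rect_schur_mult_in_I_span [OF l mult_in_V_span [OF u assms(2)]])
  qed
  show ?thesis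
    using span_mult [OF assms(1) [unfolded I_span_def] mseries.span_base [of g "{g}"],
        of "adapted k ` (msets {1..k} - irreducibles k)"] gen
    unfolding I_span_def by blast
qed

lemma V_span_decomposition:
  assumes "f \<in> V_span k"
  obtains g j where "g \<in> mseries.span (monomial hsym ` irreducibles k)" "j \<in> I_span k" "f = g + j"
proof -
  have "msets {1..k} = irreducibles k \<union> (msets {1..k} - irreducibles k)"
    by (auto simp: irreducibles_def)
  then have "adapted k ` msets {1..k} =
      adapted k ` irreducibles k \<union> adapted k ` (msets {1..k} - irreducibles k)"
    by (metis image_Un)
  moreover have "adapted k ` irreducibles k = monomial hsym ` irreducibles k"
    using adapted_irreducible by force
  ultimately have "f \<in> mseries.span (monomial hsym ` irreducibles k \<union>
      adapted k ` (msets {1..k} - irreducibles k))"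
    using assms by (simp add: V_span_eq)
  then show thesis using that unfolding mseries.span_Un I_span_def by auto
qed

text \<open>
Linear independence modulo the ideal, in the form of the recursive definition of independent
lists: no irreducible monomial is a combination of other ones.
\<close>

lemma irreducible_monomial_not_in_span:
  assumes S: "S \<subseteq> irreducibles k" and \<alpha>: "\<alpha> \<in> irreducibles k" "\<alpha> \<notin> S"
    and g: "g \<in> mseries.span (monomial hsym ` S)"
  shows "monomial hsym \<alpha> - g \<notin> I_span k"
proof
  assume "monomial hsym \<alpha> - g \<in> I_span k"
  let ?N = "msets {1..k} - irreducibles k"
  have "adapted k ` S = monomial hsym ` S" using S adapted_irreducible by force
  then have "g \<in> mseries.span (adapted k ` S)" using g by simp
  then have 1: "g \<in> mseries.span (adapted k ` (S \<union> ?N))"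
    by (rule subsetD [OF mseries.span_mono, rotated]) auto
  have 2: "monomial hsym \<alpha> - g \<in> mseries.span (adapted k ` (S \<union> ?N))"
    using \<open>monomial hsym \<alpha> - g \<in> I_span k\<close> unfolding I_span_def
    by (rule subsetD [OF mseries.span_mono, rotated]) auto
  have "(monomial hsym \<alpha> - g) + g \<in> mseries.span (adapted k ` (S \<union> ?N))"
    using 1 2 by (intro mseries.span_add)
  then have "adapted k \<alpha> \<in> mseries.span (adapted k ` (S \<union> ?N))"
    using adapted_irreducible [OF \<alpha>(1)] by simp
  then have "(\<Sum>i\<in>{\<alpha>}. scale 1 (adapted k i)) \<in> mseries.span (adapted k ` (S \<union> ?N))" by simp
  then have "(1 :: rat) = 0"
    by (rule indep_family_disjoint [OF indep_family_adapted, rotated 4, where i = \<alpha>])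
       (use S \<alpha> in \<open>auto simp: irreducibles_def\<close>)
  then show False by simp
qed

section \<open>The quotient ring\<close>

lemma coeff_Mseries_surj: "\<exists>g. f = coeff g"
  by (metis coeff_Mseries)

lemma mfps_ring_simps [simp]:
  "carrier mfps_ring = UNIV"
  "coeff f \<otimes>\<^bsub>mfps_ring\<^esub> coeff g = coeff (f * g)"
  "coeff f \<oplus>\<^bsub>mfps_ring\<^esub> coeff g = coeff (f + g)"
  "\<one>\<^bsub>mfps_ring\<^esub> = coeff 1" "\<zero>\<^bsub>mfps_ring\<^esub> = coeff 0"
  by (auto simp: mfps_ring_def coeff_mult coeff_1 fun_eq_iff)

text \<open>
From here on, power series occur as arguments of the operations of a ring record, where the
coefficient function of a series must not be expanded pointwise.
\<close>

declare coeff_0 [simp del] coeff_add [simp del] coeff_uminus [simp del] coeff_scale [simp del]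
  coeff_hsym [simp del] coeff_schur_series [simp del]

lemma cring_mfps_ring: "cring mfps_ring"
proof (rule cringI)
  show "abelian_group mfps_ring"
  proof (rule abelian_groupI)
    fix x y z assume "x \<in> carrier mfps_ring" "y \<in> carrier mfps_ring" "z \<in> carrier mfps_ring"
    obtain f g h where [simp]: "x = coeff f" "y = coeff g" "z = coeff h" using coeff_Mseries_surj
      by blast
    show "x \<oplus>\<^bsub>mfps_ring\<^esub> y \<oplus>\<^bsub>mfps_ring\<^esub> z = x \<oplus>\<^bsub>mfps_ring\<^esub> (y \<oplus>\<^bsub>mfps_ring\<^esub> z)"
      by (simp add: add.assoc)
    show "x \<oplus>\<^bsub>mfps_ring\<^esub> y = y \<oplus>\<^bsub>mfps_ring\<^esub> x" by (simp add: add.commute)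
    show "\<zero>\<^bsub>mfps_ring\<^esub> \<oplus>\<^bsub>mfps_ring\<^esub> x = x" by simp
    show "\<exists>y\<in>carrier mfps_ring. y \<oplus>\<^bsub>mfps_ring\<^esub> x = \<zero>\<^bsub>mfps_ring\<^esub>"
      by (rule bexI [of _ "coeff (- f)"]) simp_all
  qed auto
  show "comm_monoid mfps_ring"
  proof (rule comm_monoidI)
    fix x y z assume "x \<in> carrier mfps_ring" "y \<in> carrier mfps_ring" "z \<in> carrier mfps_ring"
    obtain f g h where [simp]: "x = coeff f" "y = coeff g" "z = coeff h" using coeff_Mseries_surj
      by blast
    show "x \<otimes>\<^bsub>mfps_ring\<^esub> y \<otimes>\<^bsub>mfps_ring\<^esub> z = x \<otimes>\<^bsub>mfps_ring\<^esub> (y \<otimes>\<^bsub>mfps_ring\<^esub> z)"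
      by (simp add: mult.assoc)
    show "x \<otimes>\<^bsub>mfps_ring\<^esub> y = y \<otimes>\<^bsub>mfps_ring\<^esub> x" by (simp add: mult.commute)
    show "\<one>\<^bsub>mfps_ring\<^esub> \<otimes>\<^bsub>mfps_ring\<^esub> x = x" by simp
  qed auto
  fix x y z assume "x \<in> carrier mfps_ring" "y \<in> carrier mfps_ring" "z \<in> carrier mfps_ring"
  obtain f g h where [simp]: "x = coeff f" "y = coeff g" "z = coeff h" using coeff_Mseries_surj
    by blast
  show "(x \<oplus>\<^bsub>mfps_ring\<^esub> y) \<otimes>\<^bsub>mfps_ring\<^esub> z = x \<otimes>\<^bsub>mfps_ring\<^esub> z \<oplus>\<^bsub>mfps_ring\<^esub> y \<otimes>\<^bsub>mfps_ring\<^esub> z"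
    by (simp add: distrib_right)
qed

lemma a_inv_mfps_ring [simp]: "\<ominus>\<^bsub>mfps_ring\<^esub> coeff f = coeff (- f)"
proof -
  interpret cring mfps_ring by (rule cring_mfps_ring)
  show ?thesis by (rule minus_equality) simp_all
qed

lemma complete_hom_eq: "complete_hom n = coeff (hsym n)"
  by (simp add: hsym_def)

lemma mfps_const_eq: "mfps_const c = coeff (const c)"
  by (simp add: const_def)

lemma complete_homs_eq: "complete_homs la = coeff (monomial hsym (mset la))"
  unfolding complete_homs_def by (induction la) (auto simp: complete_hom_eq)

lemma schur_eq: "schur la = coeff (schur_series la)"
  by (simp add: schur_series_def)

lemma const_in_V_span: "const c \<in> V_span k"
  unfolding const_eq_scale using one_in_V_span subspace_V_span
    by (rule mseries.subspace_scale [rotated])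

lemma V_ring_simps [simp]:
  "monoid.mult (V_ring k) = monoid.mult mfps_ring" "one (V_ring k) = one mfps_ring"
  "zero (V_ring k) = zero mfps_ring" "add (V_ring k) = add mfps_ring"
  by (simp_all add: V_ring_def)

text \<open>
The generated subring is the span of the monomials, because that span is closed under products.
\<close>

lemma carrier_V_ring: "carrier (V_ring k) = coeff ` V_span k"
proof -
  let ?G = "range mfps_const \<union> complete_hom ` {1..k}"
  have "x \<in> coeff ` V_span k" if "x \<in> generate_ring mfps_ring ?G" for x
    using that
  proof induction
    case one
    then show ?case using one_in_V_span by simp
  next
    case (incl h)
    then show ?case using const_in_V_span hsym_in_V_span by (auto simp: mfps_const_eq complete_hom_eq)
  next
    case (a_inv h)
    then show ?case using mseries.subspace_neg [OF subspace_V_span] by auto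
  next
    case (eng_add h1 h2)
    then show ?case using mseries.subspace_add [OF subspace_V_span] by auto
  next
    case (eng_mult h1 h2)
    then show ?case using mult_in_V_span by auto
  qed
  moreover have "coeff f \<in> generate_ring mfps_ring ?G" if "f \<in> V_span k" for f
    using that unfolding V_span_def
  proof (induction rule: mseries.span_induct_alt)
    case base
    interpret cring mfps_ring by (rule cring_mfps_ring)
    show ?case using zero_in_generate by simp
  next
    case (step c x f)
    then obtain \<alpha> where x: "x = monomial hsym \<alpha>" and \<alpha>: "\<alpha> \<in> msets {1..k}" by blast
    have "coeff x \<in> generate_ring mfps_ring ?G"
      using \<alpha> unfolding x
    proof (induction \<alpha>)
      case empty
      then show ?case using generate_ring.one [of mfps_ring] by simp
    next
      case (add i \<alpha>)
      then have "coeff (hsym i) \<in> generate_ring mfps_ring ?G" "coeff (monomial hsym \<alpha>) \<in>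
          generate_ring mfps_ring ?G"
        by (auto simp: complete_hom_eq intro: generate_ring.incl)
      from generate_ring.eng_mult [OF this] show ?case by simp
    qed
    moreover have "coeff (const c) \<in> generate_ring mfps_ring ?G"
      by (auto simp: mfps_const_eq intro: generate_ring.incl)
    ultimately have "coeff (scale c x) \<in> generate_ring mfps_ring ?G"
      using generate_ring.eng_mult [of "coeff (const c)" mfps_ring ?G "coeff x"]
        by (simp add: scale_eq_const_mult)
    from generate_ring.eng_add [OF this step(2)] show ?case by simp
  qed
  ultimately show ?thesis by (auto simp: V_ring_def)
qed

lemma ring_V_ring: "ring (V_ring k)"
proof -
  interpret cring mfps_ring by (rule cring_mfps_ring)
  show ?thesis unfolding V_ring_def by (rule generate_ring_is_ring) simp
qed

lemma a_inv_V_ring: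
  assumes "f \<in> V_span k"
  shows "\<ominus>\<^bsub>V_ring k\<^esub> coeff f = coeff (- f)"
proof -
  interpret ring "V_ring k" by (rule ring_V_ring)
  show ?thesis
    by (rule minus_equality)
       (use assms mseries.subspace_neg [OF subspace_V_span] in \<open>auto simp: carrier_V_ring\<close>)
qed

lemma ideal_I_span: "ideal (coeff ` I_span k) (V_ring k)"
proof (rule idealI [OF ring_V_ring])
  interpret ring "V_ring k" by (rule ring_V_ring)
  show "subgroup (coeff ` I_span k) (add_monoid (V_ring k))"
  proof (rule add.subgroupI)
    show "coeff ` I_span k \<subseteq> carrier (V_ring k)"
      unfolding carrier_V_ring using I_span_subset_V_span by (rule image_mono)
    show "coeff ` I_span k \<noteq> {}" using mseries.subspace_0 [OF subspace_I_span] by blast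
    fix a assume "a \<in> coeff ` I_span k"
    then obtain f where f: "a = coeff f" "f \<in> I_span k" by blast
    then have "\<ominus>\<^bsub>V_ring k\<^esub> a = coeff (- f)"
      using a_inv_V_ring I_span_subset_V_span by blast
    then show "\<ominus>\<^bsub>V_ring k\<^esub> a \<in> coeff ` I_span k"
      using f mseries.subspace_neg [OF subspace_I_span] by blast
    fix b assume "b \<in> coeff ` I_span k"
    then show "a \<oplus>\<^bsub>V_ring k\<^esub> b \<in> coeff ` I_span k"
      using f mseries.subspace_add [OF subspace_I_span] by auto
  qed
  fix a x assume "a \<in> coeff ` I_span k" "x \<in> carrier (V_ring k)"
  then obtain f g where fg: "a = coeff f" "x = coeff g" "f \<in> I_span k" "g \<in> V_span k"
    by (auto simp: carrier_V_ring)
  then have "f * g \<in> I_span k" by (simp add: I_span_ideal)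
  then show "a \<otimes>\<^bsub>V_ring k\<^esub> x \<in> coeff ` I_span k" "x \<otimes>\<^bsub>V_ring k\<^esub> a \<in> coeff ` I_span k"
    using fg by (auto simp: mult.commute)
qed

text \<open>
One inclusion holds as the span is an ideal that contains the generators; the other one as each
spanning element is a multiple of a generator.
\<close>

lemma rect_ideal_eq: "rect_ideal k = coeff ` I_span k"
proof -
  interpret ring "V_ring k" by (rule ring_V_ring)
  let ?S = "(\<lambda>l. schur (k_rectangle k l)) ` {1..k}"
  have S: "?S \<subseteq> carrier (V_ring k)"
    using rect_schur_in_V_span by (auto simp: carrier_V_ring schur_eq)
  have "?S \<subseteq> coeff ` I_span k"
    using rect_schur_mult_in_I_span [OF _ one_in_V_span] by (force simp: schur_eq)
  then have 1: "rect_ideal k \<subseteq> coeff ` I_span k"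
    unfolding rect_ideal_def by (rule genideal_minimal [OF ideal_I_span])
  interpret I: ideal "rect_ideal k" "V_ring k"
    unfolding rect_ideal_def by (rule genideal_ideal [OF S])
  have gen: "coeff (rect_schur k l) \<in> rect_ideal k" if "l \<in> {1..k}" for l
    using genideal_self [OF S] that unfolding rect_ideal_def by (auto simp: schur_eq)
  have mult: "coeff (f * g) \<in> rect_ideal k" if "coeff f \<in> rect_ideal k" "g \<in> V_span k" for f g
    using I.I_r_closed [of "coeff f" "coeff g"] that by (simp add: carrier_V_ring)
  have "coeff f \<in> rect_ideal k" if "f \<in> I_span k" for f
    using that unfolding I_span_def
  proof (induction rule: mseries.span_induct_alt)
    case base
    show ?case using I.zero_closed by simp
  next
    case (step c x f)
    then obtain \<gamma> where \<gamma>: "\<gamma> \<in> msets {1..k} - irreducibles k" and x: "x = adapted k \<gamma>" by blast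
    obtain l u where l: "l \<in> {1..k}" and u: "u \<in> V_span k" and eq: "adapted k \<gamma> = rect_schur k l * u"
      using adapted_factor [OF \<gamma>] .
    have "scale c x = rect_schur k l * scale c u" by (simp add: x eq scale_mult_right)
    moreover have "coeff (rect_schur k l * scale c u) \<in> rect_ideal k"
      by (rule mult [OF gen [OF l] mseries.subspace_scale [OF subspace_V_span u]])
    ultimately have "coeff (scale c x) \<in> rect_ideal k" by simp
    from I.a_closed [OF this step(2)] show ?case by simp
  qed
  then show ?thesis using 1 by auto
qed

definition quot_class :: "nat \<Rightarrow> mseries \<Rightarrow> mfps set" where
  "quot_class k f = quot_map k (coeff f)"

lemma ideal_rect_ideal: "ideal (rect_ideal k) (V_ring k)"
  unfolding rect_ideal_eq by (rule ideal_I_span)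

lemma quot_class_eq_imp:
  assumes "quot_class k f = quot_class k g"
  shows "f - g \<in> I_span k"
proof -
  have cls: "quot_class k h = (\<lambda>j. coeff (j + h)) ` I_span k" for h
    unfolding quot_class_def quot_map_def a_r_coset_def' rect_ideal_eq
    by (simp add: image_image UNION_singleton_eq_range)
  have "coeff f \<in> quot_class k f"
    unfolding cls using mseries.subspace_0 [OF subspace_I_span, of k]
      by (intro image_eqI [of _ _ 0]) simp_all
  then have "coeff f \<in> (\<lambda>j. coeff (j + g)) ` I_span k"
    unfolding assms unfolding cls .
  then obtain j where j: "j \<in> I_span k" "coeff f = coeff (j + g)" by (rule imageE)
  then have "f = j + g" by (simp only: coeff_inject)
  then show ?thesis using j(1) by simp
qed

lemma quot_class_I_span:
  assumes "j \<in> I_span k" "f \<in> V_span k"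
  shows "quot_class k (f + j) = quot_class k f"
proof -
  interpret I: ideal "rect_ideal k" "V_ring k" by (rule ideal_rect_ideal)
  have "coeff j \<in> rect_ideal k" using assms by (simp add: rect_ideal_eq)
  then have "coeff (j + f) \<in> rect_ideal k +>\<^bsub>V_ring k\<^esub> coeff f"
    unfolding a_r_coset_def' by (intro UN_I [of "coeff j"]) simp_all
  then have "rect_ideal k +>\<^bsub>V_ring k\<^esub> coeff f = rect_ideal k +>\<^bsub>V_ring k\<^esub> coeff (j + f)"
    by (rule I.a_repr_independence [OF _ _ I.a_subgroup]) (use assms in \<open>simp add: carrier_V_ring\<close>)
  then show ?thesis by (simp add: quot_class_def quot_map_def add.commute)
qed

lemma ring_V_quot: "ring (V_quot k)"
  unfolding V_quot_def by (rule ideal.quotient_is_ring [OF ideal_rect_ideal])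

lemma carrier_V_quot: "carrier (V_quot k) = quot_class k ` V_span k"
proof -
  have "carrier (V_quot k) = (\<Union>x\<in>coeff ` V_span k. {rect_ideal k +>\<^bsub>V_ring k\<^esub> x})"
    by (simp add: V_quot_def FactRing_def A_RCOSETS_def' carrier_V_ring)
  then show ?thesis unfolding quot_class_def quot_map_def by blast
qed

lemma quot_class_add:
  assumes "f \<in> V_span k" "g \<in> V_span k"
  shows "quot_class k f \<oplus>\<^bsub>V_quot k\<^esub> quot_class k g = quot_class k (f + g)"
  using ring_hom_add [OF ideal.rcos_ring_hom [OF ideal_rect_ideal [of k]], of "coeff f" "coeff g"]
      assms
  by (simp add: carrier_V_ring quot_class_def quot_map_def V_quot_def)

lemma quot_class_mult:
  assumes "f \<in> V_span k" "g \<in> V_span k"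
  shows "quot_class k f \<otimes>\<^bsub>V_quot k\<^esub> quot_class k g = quot_class k (f * g)"
  using ring_hom_mult [OF ideal.rcos_ring_hom [OF ideal_rect_ideal [of k]], of "coeff f" "coeff g"]
      assms
  by (simp add: carrier_V_ring quot_class_def quot_map_def V_quot_def)

lemma quot_class_0: "quot_class k 0 = \<zero>\<^bsub>V_quot k\<^esub>"
  using ring_hom_zero [OF ideal.rcos_ring_hom [OF ideal_rect_ideal [of k]] ring_V_ring
      ideal.quotient_is_ring [OF ideal_rect_ideal]]
  by (simp add: quot_class_def quot_map_def V_quot_def)

lemma quot_scalars_eq: "quot_scalars k = (\<lambda>c. quot_class k (const c)) ` UNIV"
  by (auto simp: quot_scalars_def quot_class_def mfps_const_eq)

text \<open>
Spans over the embedded scalars are the images of the spans over \<open>\<rat>\<close>. Through this, independence and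
spanning in the quotient become statements about power series modulo \<open>I_span k\<close>.
\<close>

lemma Span_quot_class:
  assumes "set gs \<subseteq> V_span k"
  shows "ring.Span (V_quot k) (quot_scalars k) (map (quot_class k) gs) =
    quot_class k ` mseries.span (set gs)"
  using assms
proof (induction gs)
  case Nil
  interpret ring "V_quot k" by (rule ring_V_quot)
  show ?case by (simp add: quot_class_0)
next
  case (Cons g gs)
  interpret ring "V_quot k" by (rule ring_V_quot)
  have g: "g \<in> V_span k" and gs: "set gs \<subseteq> V_span k" using Cons.prems by auto
  have span: "mseries.span (set gs) \<subseteq> V_span k"
    using gs subspace_V_span by (rule mseries.span_minimal)
  have comb: "quot_class k (const c) \<otimes>\<^bsub>V_quot k\<^esub> quot_class k g \<oplus>\<^bsub>V_quot k\<^esub> quot_class k v =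
      quot_class k (scale c g + v)" if "v \<in> mseries.span (set gs)" for c v
    using that g span const_in_V_span
    by (subst quot_class_mult, simp, simp, subst quot_class_add)
       (auto simp: scale_eq_const_mult intro: mult_in_V_span)
  have "Span (quot_scalars k) (map (quot_class k) (g # gs)) =
      line_extension (quot_scalars k) (quot_class k g) (quot_class k ` mseries.span (set gs))"
    using Cons.IH [OF gs] by simp
  also have "\<dots> = quot_class k ` {scale c g + v | c v. v \<in> mseries.span (set gs)}" (is "?L = ?R")
  proof (intro equalityI subsetI)
    fix x assume "x \<in> ?L"
    then obtain c v where "v \<in> mseries.span (set gs)"
      "x = quot_class k (const c) \<otimes>\<^bsub>V_quot k\<^esub> quot_class k g \<oplus>\<^bsub>V_quot k\<^esub> quot_class k v"
      unfolding line_extension_mem_iff quot_scalars_eq by blast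
    then show "x \<in> ?R" using comb by blast
  next
    fix x assume "x \<in> ?R"
    then obtain c v where v: "v \<in> mseries.span (set gs)" "x = quot_class k (scale c g + v)" by blast
    then have "x = quot_class k (const c) \<otimes>\<^bsub>V_quot k\<^esub> quot_class k g \<oplus>\<^bsub>V_quot k\<^esub> quot_class k v"
      using comb by simp
    then show "x \<in> ?L" unfolding line_extension_mem_iff quot_scalars_eq using v(1) by blast
  qed
  also have "{scale c g + v | c v. v \<in> mseries.span (set gs)} = mseries.span (set (g # gs))"
  proof (intro equalityI subsetI)
    fix x assume "x \<in> {scale c g + v | c v. v \<in> mseries.span (set gs)}"
    then obtain c v where "v \<in> mseries.span (set gs)" "x = scale c g + v" by blast
    then have "x - scale c g \<in> mseries.span (set gs)" by simp
    then show "x \<in> mseries.span (set (g # gs))" unfolding list.set mseries.span_insert by blast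
  next
    fix x assume "x \<in> mseries.span (set (g # gs))"
    then obtain c where "x - scale c g \<in> mseries.span (set gs)"
      unfolding list.set mseries.span_insert by blast
    moreover have "x = scale c g + (x - scale c g)" by simp
    ultimately show "x \<in> {scale c g + v | c v. v \<in> mseries.span (set gs)}" by blast
  qed
  finally show ?case .
qed

section \<open>Irreducible partitions\<close>

lemma k_irreducible_iff:
  "k_irreducible k la \<longleftrightarrow> sorted_wrt (\<ge>) la \<and> mset la \<in> irreducibles k"
proof -
  have "(\<forall>i<k. count_list la (k - i) \<le> i) \<longleftrightarrow> (\<forall>l\<in>{1..k}. count (mset la) l \<le> k - l)"
  proof
    assume *: "\<forall>i<k. count_list la (k - i) \<le> i"
    show "\<forall>l\<in>{1..k}. count (mset la) l \<le> k - l"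
    proof
      fix l assume "l \<in> {1..k}"
      then show "count (mset la) l \<le> k - l" using *[rule_format, of "k - l"] by (simp add: count_mset)
    qed
  next
    assume *: "\<forall>l\<in>{1..k}. count (mset la) l \<le> k - l"
    show "\<forall>i<k. count_list la (k - i) \<le> i"
    proof (intro allI impI)
      fix i assume "i < k"
      then show "count_list la (k - i) \<le> i" using *[rule_format, of "k - i"] by (simp add: count_mset)
    qed
  qed
  moreover have "0 \<notin> set la \<and> (\<forall>p\<in>set la. p \<le> k) \<longleftrightarrow> mset la \<in> msets {1..k}"
    by (auto simp: msets_def Suc_le_eq intro: gr0I)
  ultimately show ?thesis
    unfolding k_irreducible_def is_partition_def irreducibles_def by auto
qed

lemma bij_betw_mset_k_irreducible: "bij_betw mset {la. k_irreducible k la} (irreducibles k)"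
proof (rule bij_betwI [where g = "\<lambda>\<alpha>. rev (sorted_list_of_multiset \<alpha>)"])
  have rev: "sorted_wrt (\<ge>) la \<longleftrightarrow> sorted (rev la)" for la :: "nat list"
    by (simp add: sorted_wrt_rev)
  show "mset \<in> {la. k_irreducible k la} \<rightarrow> irreducibles k"
    by (auto simp: k_irreducible_iff)
  show "(\<lambda>\<alpha>. rev (sorted_list_of_multiset \<alpha>)) \<in> irreducibles k \<rightarrow> {la. k_irreducible k la}"
    by (auto simp: k_irreducible_iff rev)
  show "rev (sorted_list_of_multiset (mset la)) = la" if "la \<in> {la. k_irreducible k la}" for la
  proof -
    have "sort la = rev la"
      using that by (intro properties_for_sort) (auto simp: k_irreducible_iff rev)
    then show ?thesis by (simp add: sorted_list_of_multiset_mset)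
  qed
qed simp

lemma finite_irreducibles: "finite (irreducibles k)"
proof (rule finite_subset)
  show "irreducibles k \<subseteq> mset ` {xs. set xs \<subseteq> {1..k} \<and> length xs \<le> (\<Sum>l\<in>{1..k}. k - l)}"
  proof
    fix \<alpha> assume \<alpha>: "\<alpha> \<in> irreducibles k"
    obtain xs where xs: "mset xs = \<alpha>" using ex_mset by blast
    have "size \<alpha> = (\<Sum>l\<in>set_mset \<alpha>. count \<alpha> l)" by (simp add: size_multiset_overloaded_eq)
    also have "\<dots> \<le> (\<Sum>l\<in>{1..k}. count \<alpha> l)"
      by (rule sum_mono2) (use \<alpha> in \<open>auto simp: irreducibles_def msets_def\<close>)
    also have "\<dots> \<le> (\<Sum>l\<in>{1..k}. k - l)"
      by (rule sum_mono) (use \<alpha> in \<open>auto simp: irreducibles_def\<close>)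
    finally have "length xs \<le> (\<Sum>l\<in>{1..k}. k - l)" using xs by auto
    moreover have "set xs \<subseteq> {1..k}" using \<alpha> xs by (auto simp: irreducibles_def msets_def)
    ultimately show "\<alpha> \<in> mset ` {xs. set xs \<subseteq> {1..k} \<and> length xs \<le> (\<Sum>l\<in>{1..k}. k - l)}"
      using xs by blast
  qed
qed (auto intro: finite_lists_length_le)

theorem proposition26:
  fixes k :: nat
  assumes "k \<ge> 1"
  shows "is_basis_family (V_quot k) (quot_scalars k)
           (\<lambda>la. quot_map k (complete_homs la)) {la. k_irreducible k la}"
  unfolding is_basis_family_def
proof (intro conjI allI impI)
  interpret ring "V_quot k" by (rule ring_V_quot)
  let ?H = "\<lambda>la. monomial hsym (mset la)"
  let ?v = "\<lambda>la. quot_map k (complete_homs la)"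
  have v: "map ?v as = map (quot_class k) (map ?H as)" for as
    by (simp add: quot_class_def complete_homs_eq)
  have V: "monomial hsym \<alpha> \<in> V_span k" if "\<alpha> \<in> irreducibles k" for \<alpha>
    using that by (auto simp: irreducibles_def intro: monomial_hsym_in_V_span)
  show "finite {la. k_irreducible k la}"
    using bij_betw_finite [OF bij_betw_mset_k_irreducible] finite_irreducibles by blast
  fix as assume as: "distinct as \<and> set as = {la. k_irreducible k la}"
  have "independent (quot_scalars k) (map ?v bs)"
    if "distinct bs" "set bs \<subseteq> {la. k_irreducible k la}" for bs
    using that
  proof (induction bs)
    case (Cons la bs)
    have inj: "inj_on mset {la. k_irreducible k la}"
      using bij_betw_mset_k_irreducible by (rule bij_betw_imp_inj_on)
    have la: "mset la \<in> irreducibles k" and bs: "mset ` set bs \<subseteq> irreducibles k"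
      using Cons.prems by (auto simp: k_irreducible_iff)
    have notin: "mset la \<notin> mset ` set bs"
      using Cons.prems inj by (auto dest: inj_onD)
    have HV: "set (map ?H bs) \<subseteq> V_span k" using bs V by auto
    have "?v la \<notin> Span (quot_scalars k) (map ?v bs)"
    proof
      assume "?v la \<in> Span (quot_scalars k) (map ?v bs)"
      then obtain g where g: "g \<in> mseries.span (?H ` set bs)" "quot_class k (?H la) = quot_class k g"
        unfolding v Span_quot_class [OF HV] by (auto simp: quot_class_def complete_homs_eq)
      then have "?H la - g \<in> I_span k" by (intro quot_class_eq_imp)
      moreover have "g \<in> mseries.span (monomial hsym ` mset ` set bs)" using g
        by (simp add: image_image)
      ultimately show False using irreducible_monomial_not_in_span [OF bs la notin] by blast
    qed
    moreover have "?v la \<in> carrier (V_quot k)"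
      using V [OF la] by (auto simp: carrier_V_quot quot_class_def complete_homs_eq)
    moreover have "independent (quot_scalars k) (map ?v bs)" using Cons by simp
    ultimately show ?case unfolding list.map by (intro li_Cons)
  qed simp
  then show "independent (quot_scalars k) (map ?v as)" using as by blast
  have mset_as: "mset ` set as = irreducibles k"
    using as bij_betw_mset_k_irreducible by (simp add: bij_betw_def)
  have "set (map ?H as) \<subseteq> V_span k" using mset_as V by auto
  then have "Span (quot_scalars k) (map ?v as) = quot_class k ` mseries.span (set (map ?H as))"
    unfolding v by (rule Span_quot_class)
  also have "set (map ?H as) = monomial hsym ` irreducibles k"
    unfolding mset_as [symmetric] by auto
  also have "quot_class k ` mseries.span (monomial hsym ` irreducibles k) = carrier (V_quot k)"
  proof -
    have sub: "mseries.span (monomial hsym ` irreducibles k) \<subseteq> V_span k"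
      using V by (intro mseries.span_minimal subspace_V_span) auto
    have "quot_class k f \<in> quot_class k ` mseries.span (monomial hsym ` irreducibles k)"
      if f: "f \<in> V_span k" for f
    proof -
      obtain g j where g: "g \<in> mseries.span (monomial hsym ` irreducibles k)"
        and j: "j \<in> I_span k" and eq: "f = g + j"
        using V_span_decomposition [OF f] .
      have "quot_class k f = quot_class k g"
        unfolding eq using j g sub by (intro quot_class_I_span) auto
      then show ?thesis using g by blast
    qed
    then show ?thesis using sub by (auto simp: carrier_V_quot)
  qed
  finally show "Span (quot_scalars k) (map ?v as) = carrier (V_quot k)" .
qed

end
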